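(* Let $k$ be a field of characteristic $0$. Let $\mathfrak{g}$ be a finite-dimensional colour Lie algebra whose $\epsilon$-Killing form $B_{\mathfrak{g}}$ is non-degenerate, and suppose that $(\mathfrak{g},B_{\mathfrak{g}})$ is basic (as defined in the context). Let $\mathfrak{h}$ be a Cartan subalgebra and $\Delta^+$ a choice of positive roots for the action of $ad(\mathfrak{h})$, both as in the definition of basic, and let $\rho$ be the corresponding Weyl vector. Then $$\dim_{\epsilon}(\mathfrak{g})=24\,B_{\mathfrak{g}^*}(\rho,\rho).$$
   Context: Graded conventions. $\Gamma$ is an abelian group (written additively) and $\epsilon:\Gamma\times\Gamma\to k^{\times}$ is a commutation factor: $\epsilon(a,b)\epsilon(b,a)=1$, $\epsilon(a+b,c)=\epsilon(a,c)\epsilon(b,c)$, $\epsilon(a,b+c)=\epsilon(a,b)\epsilon(a,c)$. For homogeneous elements $v,w$ of $\Gamma$-graded vector spaces, of degrees $|v|,|w|$, write $\epsilon(v,w)=\epsilon(|v|,|w|)$ and $\epsilon(v)=\epsilon(|v|,|v|)$. Formulas involving degrees are for homogeneous elements and are extended by linearity. For a finite-dimensional $\Gamma$-graded space $V$ and $f\in \mathrm{End}(V)$, $Tr_{\epsilon}(f):=Tr(\mathcal{E}\circ f)$ with $\mathcal{E}(v)=\epsilon(v)v$, and $\dim_\epsilon(V):=Tr_\epsilon(Id_V)$. Bilinear forms are of degree $0$ ($B(V_a,V_b)=0$ unless $a+b=0$). Colour Lie algebra: a $\Gamma$-graded vector space $\mathfrak{g}$ with a bilinear bracket $\{\ ,\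 \}$ such that $\{\mathfrak{g}_a,\mathfrak{g}_b\}\subseteq\mathfrak{g}_{a+b}$, $\{x,y\}=-\epsilon(x,y)\{y,x\}$ and $\epsilon(z,x)\{x,\{y,z\}\}+\epsilon(x,y)\{y,\{z,x\}\}+\epsilon(y,z)\{z,\{x,y\}\}=0$. Put $ad(x)=\{x,\cdot\}$. The $\epsilon$-Killing form is $K(x,y)=Tr_\epsilon(ad(x)ad(y))$. A pair $(\mathfrak{g},B_{\mathfrak{g}})$ is $\epsilon$-quadratic if $B_{\mathfrak{g}}$ is a non-degenerate bilinear form with $B_{\mathfrak{g}}(x,y)=\epsilon(x,y)B_{\mathfrak{g}}(y,x)$ and $B_{\mathfrak{g}}(\{x,y\},z)=-\epsilon(x,y)B_{\mathfrak{g}}(y,\{x,z\})$. Basic. A finite-dimensional $\epsilon$-quadratic colour Lie algebra $(\mathfrak{g},B_{\mathfrak{g}})$ over a field of characteristic $0$ is basic if there is a Cartan subalgebra $\mathfrak{h}$ of the Lie algebra $\mathfrak{g}_0$ (the degree $0$ component) such that, with $\mathfrak{g}^\alpha=\{x\in\mathfrak{g}\mid \{h,x\}=\alpha(h)x\ \forall h\in\mathfrak{h}\}$ for $\alpha\in\mathfrak{h}^*$: (i) $\dim(\mathfrak{g}^\alpha)\le 1$ for all $\alpha\neq 0$; (ii) $\mathfrak{g}=\bigoplus_{\alpha\in\mathfrak{h}^*}\mathfrak{g}^\alpha$; (iii) $\mathfrak{g}^0=\mathfrak{h}$; (iv) the set of roots $\Delta=\{\alpha\ne 0\mid \mathfrak{g}^\alpha\ne\{0\}\}$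 is a disjoint union $\Delta=\Delta^+\cup\Delta^-$ with $\alpha\in\Delta^{\pm}\Rightarrow-\alpha\in\Delta^{\mp}$, and such that $\sum_{\alpha\in\Delta^{\pm}}c_\alpha\alpha=0$ with integers $c_\alpha\ge 0$ implies all $c_\alpha=0$. Elements of $\Delta^+$ are the positive roots. For a root $\alpha$, $\epsilon(\alpha):=\epsilon(x)$ for any non-zero $x\in\mathfrak{g}^\alpha$. The Weyl vector is $\rho=\frac12\sum_{\alpha\in\Delta^+}\epsilon(\alpha)\alpha\in\mathfrak{h}^*$. The restriction of $B_{\mathfrak{g}}$ to $\mathfrak{h}$ is non-degenerate; for $\alpha\in\mathfrak{h}^*$ let $h_\alpha\in\mathfrak{h}$ be the element with $\alpha=B_{\mathfrak{g}}(h_\alpha,\cdot)|_{\mathfrak{h}}$, and set $B_{\mathfrak{g}^*}(\alpha,\beta):=B_{\mathfrak{g}}(h_\alpha,h_\beta)$ for $\alpha,\beta\in\mathfrak{h}^*$. *)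

theory Defs
  imports Complex_Main
begin

definition is_decomposition :: "'i set \<Rightarrow> ('i \<Rightarrow> 'v::ab_group_add set) \<Rightarrow> 'v \<Rightarrow> ('i \<Rightarrow> 'v) \<Rightarrow> bool" where
  "is_decomposition I W x f \<longleftrightarrow>
     (\<forall>i\<in>I. f i \<in> W i) \<and> (\<forall>i. i \<notin> I \<longrightarrow> f i = 0) \<and>
     finite {i. f i \<noteq> 0} \<and> x = (\<Sum>i | f i \<noteq> 0. f i)"

definition internal_direct_sum :: "'i set \<Rightarrow> ('i \<Rightarrow> 'v::ab_group_add set) \<Rightarrow> bool" where
  "internal_direct_sum I W \<longleftrightarrow> (\<forall>x. \<exists>!f. is_decomposition I W x f)"

context vector_space
begin

definition finite_dimensional :: bool where
  "finite_dimensional \<longleftrightarrow> (\<exists>S. finite S \<and> span S = UNIV)"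

(* extend_basis {} is a basis of the whole space; the trace of an endomorphism of a
   finite-dimensional space does not depend on this choice. *)
definition trace :: "('b \<Rightarrow> 'b) \<Rightarrow> 'a" where
  "trace f = (\<Sum>b\<in>extend_basis {}. representation (extend_basis {}) (f b) b)"

end

locale commutation_factor =
  fixes eps :: "'g::ab_group_add \<Rightarrow> 'g \<Rightarrow> 'k::field_char_0"
  assumes eps_inverse: "eps a b * eps b a = 1"
    and eps_add_left: "eps (a + b) c = eps a c * eps b c"
    and eps_add_right: "eps a (b + c) = eps a b * eps a c"

locale graded_vector_space = vector_space scale
  for scale :: "'k::field_char_0 \<Rightarrow> 'v::ab_group_add \<Rightarrow> 'v" (infixr "*s" 75) +
  fixes V :: "'g::ab_group_add \<Rightarrow> 'v set"
  assumes subspace_component: "subspace (V a)"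
    and grading: "internal_direct_sum UNIV V"

locale eps_graded_vector_space =
  graded_vector_space scale V + commutation_factor eps
  for scale :: "'k::field_char_0 \<Rightarrow> 'v::ab_group_add \<Rightarrow> 'v" (infixr "*s" 75)
    and V :: "'g::ab_group_add \<Rightarrow> 'v set"
    and eps :: "'g \<Rightarrow> 'g \<Rightarrow> 'k"
begin

definition component :: "'v \<Rightarrow> 'g \<Rightarrow> 'v" where
  "component x = (THE f. is_decomposition UNIV V x f)"

(* The linear map with v \<mapsto> eps(|v|,|v|) v on homogeneous v. *)
definition eps_map :: "'v \<Rightarrow> 'v" where
  "eps_map x = (\<Sum>a | component x a \<noteq> 0. eps a a *s component x a)"

definition eps_trace :: "('v \<Rightarrow> 'v) \<Rightarrow> 'k" where
  "eps_trace f = trace (eps_map \<circ> f)"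

definition eps_dim :: 'k where
  "eps_dim = eps_trace id"

(* Meaningful for non-zero homogeneous x only. *)
definition deg :: "'v \<Rightarrow> 'g" where
  "deg x = (THE a. x \<in> V a)"

definition eps_el :: "'v \<Rightarrow> 'k" where
  "eps_el x = eps (deg x) (deg x)"

definition bilinear_form :: "('v \<Rightarrow> 'v \<Rightarrow> 'k) \<Rightarrow> bool" where
  "bilinear_form B \<longleftrightarrow>
     (\<forall>x. Vector_Spaces.linear scale (*) (\<lambda>y. B x y)) \<and>
     (\<forall>y. Vector_Spaces.linear scale (*) (\<lambda>x. B x y)) \<and>
     (\<forall>a b. \<forall>x\<in>V a. \<forall>y\<in>V b. a + b \<noteq> 0 \<longrightarrow> B x y = 0)"

definition nondegenerate :: "('v \<Rightarrow> 'v \<Rightarrow> 'k) \<Rightarrow> bool" where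
  "nondegenerate B \<longleftrightarrow>
     (\<forall>x. (\<forall>y. B x y = 0) \<longrightarrow> x = 0) \<and> (\<forall>y. (\<forall>x. B x y = 0) \<longrightarrow> y = 0)"

end

locale colour_lie_algebra = eps_graded_vector_space scale V eps
  for scale :: "'k::field_char_0 \<Rightarrow> 'v::ab_group_add \<Rightarrow> 'v" (infixr "*s" 75)
    and V :: "'g::ab_group_add \<Rightarrow> 'v set"
    and eps :: "'g \<Rightarrow> 'g \<Rightarrow> 'k" +
  fixes br :: "'v \<Rightarrow> 'v \<Rightarrow> 'v"
  assumes linear_br_right: "Vector_Spaces.linear scale scale (\<lambda>y. br x y)"
    and linear_br_left: "Vector_Spaces.linear scale scale (\<lambda>x. br x y)"
    and br_graded: "x \<in> V a \<Longrightarrow> y \<in> V b \<Longrightarrow> br x y \<in> V (a + b)"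
    and br_antisym: "x \<in> V a \<Longrightarrow> y \<in> V b \<Longrightarrow> br x y = - (eps a b *s br y x)"
    and br_jacobi: "x \<in> V a \<Longrightarrow> y \<in> V b \<Longrightarrow> z \<in> V c \<Longrightarrow>
      eps c a *s br x (br y z) + eps a b *s br y (br z x) + eps b c *s br z (br x y) = 0"
begin

definition ad :: "'v \<Rightarrow> 'v \<Rightarrow> 'v" where
  "ad x = (\<lambda>y. br x y)"

definition killing_form :: "'v \<Rightarrow> 'v \<Rightarrow> 'k" where
  "killing_form x y = eps_trace (ad x \<circ> ad y)"

definition eps_quadratic :: "('v \<Rightarrow> 'v \<Rightarrow> 'k) \<Rightarrow> bool" where
  "eps_quadratic B \<longleftrightarrow> bilinear_form B \<and> nondegenerate B \<and>
     (\<forall>a b. \<forall>x\<in>V a. \<forall>y\<in>V b. B x y = eps a b * B y x) \<and>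
     (\<forall>a b c. \<forall>x\<in>V a. \<forall>y\<in>V b. \<forall>z\<in>V c. B (br x y) z = - eps a b * B y (br x z))"

primrec lower_central :: "'v set \<Rightarrow> nat \<Rightarrow> 'v set" where
  "lower_central H 0 = H"
| "lower_central H (Suc n) = span {br x y | x y. x \<in> H \<and> y \<in> lower_central H n}"

(* Nilpotent self-normalising subalgebra of the Lie algebra V 0. *)
definition cartan_subalgebra :: "'v set \<Rightarrow> bool" where
  "cartan_subalgebra H \<longleftrightarrow> subspace H \<and> H \<subseteq> V 0 \<and>
     (\<forall>x\<in>H. \<forall>y\<in>H. br x y \<in> H) \<and>
     (\<exists>n. lower_central H n = {0}) \<and>
     {x \<in> V 0. \<forall>y\<in>H. br x y \<in> H} = H"

(* A linear functional on H is represented by its extension by 0 outside H,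
   so that equality of functionals is equality of functions. *)
definition dual :: "'v set \<Rightarrow> ('v \<Rightarrow> 'k) set" where
  "dual H = {\<alpha>. (\<forall>x\<in>H. \<forall>y\<in>H. \<alpha> (x + y) = \<alpha> x + \<alpha> y) \<and>
     (\<forall>c. \<forall>x\<in>H. \<alpha> (c *s x) = c * \<alpha> x) \<and> (\<forall>x. x \<notin> H \<longrightarrow> \<alpha> x = 0)}"

definition root_space :: "'v set \<Rightarrow> ('v \<Rightarrow> 'k) \<Rightarrow> 'v set" where
  "root_space H \<alpha> = {x. \<forall>h\<in>H. br h x = \<alpha> h *s x}"

definition roots :: "'v set \<Rightarrow> ('v \<Rightarrow> 'k) set" where
  "roots H = {\<alpha> \<in> dual H. \<alpha> \<noteq> (\<lambda>_. 0) \<and> root_space H \<alpha> \<noteq> {0}}"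

definition positively_independent :: "('v \<Rightarrow> 'k) set \<Rightarrow> bool" where
  "positively_independent P \<longleftrightarrow>
     (\<forall>c :: ('v \<Rightarrow> 'k) \<Rightarrow> int. (\<forall>\<alpha>\<in>P. c \<alpha> \<ge> 0) \<and> (\<forall>h. (\<Sum>\<alpha>\<in>P. of_int (c \<alpha>) * \<alpha> h) = 0)
        \<longrightarrow> (\<forall>\<alpha>\<in>P. c \<alpha> = 0))"

definition positive_system :: "'v set \<Rightarrow> ('v \<Rightarrow> 'k) set \<Rightarrow> bool" where
  "positive_system H Pos \<longleftrightarrow>
     (\<exists>Neg. roots H = Pos \<union> Neg \<and> Pos \<inter> Neg = {} \<and>
        (\<forall>\<alpha>\<in>Pos. (\<lambda>h. - \<alpha> h) \<in> Neg) \<and> (\<forall>\<alpha>\<in>Neg. (\<lambda>h. - \<alpha> h) \<in> Pos) \<and>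
        positively_independent Pos \<and> positively_independent Neg)"

definition basic_data :: "'v set \<Rightarrow> ('v \<Rightarrow> 'k) set \<Rightarrow> bool" where
  "basic_data H Pos \<longleftrightarrow> cartan_subalgebra H \<and>
     (\<forall>\<alpha>\<in>dual H. \<alpha> \<noteq> (\<lambda>_. 0) \<longrightarrow> dim (root_space H \<alpha>) \<le> 1) \<and>
     internal_direct_sum (dual H) (root_space H) \<and>
     root_space H (\<lambda>_. 0) = H \<and>
     positive_system H Pos"

definition basic :: "('v \<Rightarrow> 'v \<Rightarrow> 'k) \<Rightarrow> bool" where
  "basic B \<longleftrightarrow> finite_dimensional \<and> eps_quadratic B \<and> (\<exists>H Pos. basic_data H Pos)"

(* For basic data the root spaces are lines spanned by a homogeneous vector, so this value
   exists and is unique for every root. *)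
definition root_eps :: "'v set \<Rightarrow> ('v \<Rightarrow> 'k) \<Rightarrow> 'k" where
  "root_eps H \<alpha> = (THE e. \<forall>x\<in>root_space H \<alpha>. x \<noteq> 0 \<longrightarrow> eps_el x = e)"

definition weyl_vector :: "'v set \<Rightarrow> ('v \<Rightarrow> 'k) set \<Rightarrow> 'v \<Rightarrow> 'k" where
  "weyl_vector H Pos = (\<lambda>h. (1 / 2) * (\<Sum>\<alpha>\<in>Pos. root_eps H \<alpha> * \<alpha> h))"

definition dual_vector :: "('v \<Rightarrow> 'v \<Rightarrow> 'k) \<Rightarrow> 'v set \<Rightarrow> ('v \<Rightarrow> 'k) \<Rightarrow> 'v" where
  "dual_vector B H \<alpha> = (THE h. h \<in> H \<and> (\<forall>y\<in>H. \<alpha> y = B h y))"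

definition dual_form :: "('v \<Rightarrow> 'v \<Rightarrow> 'k) \<Rightarrow> 'v set \<Rightarrow> ('v \<Rightarrow> 'k) \<Rightarrow> ('v \<Rightarrow> 'k) \<Rightarrow> 'k" where
  "dual_form B H \<alpha> \<beta> = B (dual_vector B H \<alpha>) (dual_vector B H \<beta>)"

end

end

theory Submission
  imports Defs
begin

text \<open>
  Choose homogeneous root vectors \<open>e\<^sub>\<alpha>\<close>. On a root line \<open>\<gg>\<^sup>\<beta>\<close> the operator
  \<open>ad(e\<^sub>\<alpha>) ad(e\<^sub>-\<^sub>\<alpha>) / B(e\<^sub>\<alpha>, e\<^sub>-\<^sub>\<alpha>)\<close> is a scalar \<open>m(\<alpha>, \<beta>)\<close>; put
  \<open>w(\<alpha>, \<beta>) = \<epsilon>(\<alpha>) \<epsilon>(\<beta>) m(\<alpha>, \<beta>)\<close>. Invariance of \<open>B\<close> makes \<open>w\<close> symmetric and unchanged when both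
  roots are negated; the Jacobi identity gives
  \<open>w(\<alpha>, \<beta>) - w(-\<alpha>, \<beta>) = \<epsilon>(\<alpha>) \<epsilon>(\<beta>) (\<alpha>, \<beta>)\<close>; commuting scalars on lines gives
  \<open>w(\<alpha>, \<beta>) = w(-\<alpha>, \<beta> - \<alpha>)\<close>. Over pairs of positive roots let \<open>A = \<Sum> w(\<alpha>, \<beta>)\<close>,
  \<open>N = \<Sum> w(-\<alpha>, \<beta>)\<close> and \<open>P = \<Sum> \<epsilon>(\<alpha>) \<epsilon>(\<beta>) (\<alpha>, \<beta>) = 4 (\<rho>, \<rho>)\<close>, and let
  \<open>D = \<Sum> \<epsilon>(\<alpha>) (\<alpha>, \<alpha>)\<close> and \<open>E = \<Sum> \<epsilon>(\<alpha>)\<close> over positive roots. Sorting the pairs by the sign of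
  \<open>\<beta> - \<alpha>\<close> yields \<open>A = D + 2 N\<close>, while \<open>A - N = P\<close>. That \<open>B\<close> is the Killing form enters twice:
  evaluated on \<open>e\<^sub>\<alpha>, e\<^sub>-\<^sub>\<alpha>\<close> it gives \<open>E - D = A + N\<close>, and on the Cartan subalgebra it
  gives \<open>dim \<hh> = 2 D\<close>. Hence the \<open>\<epsilon>\<close>-dimension \<open>dim \<hh> + 2 E\<close> equals \<open>6 P = 24 (\<rho>, \<rho>)\<close>.
\<close>

section \<open>Decompositions and traces\<close>

lemma is_decompositionI:
  assumes "\<And>i. i \<in> I \<Longrightarrow> f i \<in> W i" "\<And>i. i \<notin> I \<Longrightarrow> f i = 0"
    and "finite F" "{i. f i \<noteq> 0} \<subseteq> F" "x = sum f F"
  shows "is_decomposition I W x f"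
proof -
  have "sum f F = (\<Sum>i | f i \<noteq> 0. f i)"
    by (rule sum.mono_neutral_right) (use assms in auto)
  then show ?thesis
    unfolding is_decomposition_def using assms finite_subset by blast
qed

lemma is_decomposition_sum:
  assumes "is_decomposition I W x f" "finite F" "{i. f i \<noteq> 0} \<subseteq> F"
  shows "x = sum f F"
proof -
  have "sum f F = (\<Sum>i | f i \<noteq> 0. f i)"
    by (rule sum.mono_neutral_right) (use assms in auto)
  then show ?thesis
    using assms(1) by (simp add: is_decomposition_def)
qed

lemma internal_direct_sum_unique:
  assumes "internal_direct_sum I W" "is_decomposition I W x f" "is_decomposition I W x g"
  shows "f = g"
  using assms unfolding internal_direct_sum_def by blast

text \<open>Applied with \<open>T\<close> a scalar multiplication or \<open>br h\<close>, this shows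
  that such maps commute with taking homogeneous components.\<close>

lemma is_decomposition_additive:
  assumes dec: "is_decomposition I W x f"
    and add: "\<And>y z. T (y + z) = T y + T z"
    and maps: "\<And>i y. i \<in> I \<Longrightarrow> y \<in> W i \<Longrightarrow> T y \<in> W' i"
  shows "is_decomposition I W' (T x) (\<lambda>i. T (f i))"
proof -
  have T0: "T 0 = 0"
    using add[of 0 0] by simp
  have Tsum: "T (sum g F) = (\<Sum>i\<in>F. T (g i))" if "finite F" for g :: "'a \<Rightarrow> 'b" and F
    using that by (induction F rule: finite_induct) (auto simp: T0 add)
  have "finite {i. f i \<noteq> 0}" "x = (\<Sum>i | f i \<noteq> 0. f i)"
    using dec by (simp_all add: is_decomposition_def)
  then show ?thesis
    using dec maps
    by (intro is_decompositionI[where F = "{i. f i \<noteq> 0}"])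
      (auto simp: is_decomposition_def T0 Tsum)
qed

lemma is_decomposition_plus:
  assumes f: "is_decomposition I W x f" and g: "is_decomposition I W y g"
    and closed: "\<And>i u v. i \<in> I \<Longrightarrow> u \<in> W i \<Longrightarrow> v \<in> W i \<Longrightarrow> u + v \<in> W i"
  shows "is_decomposition I W (x + y) (\<lambda>i. f i + g i)"
proof -
  let ?F = "{i. f i \<noteq> 0} \<union> {i. g i \<noteq> 0}"
  have F: "finite ?F"
    using f g by (simp add: is_decomposition_def)
  have "x + y = (\<Sum>i\<in>?F. f i + g i)"
    using is_decomposition_sum[OF f F] is_decomposition_sum[OF g F] by (simp add: sum.distrib)
  then show ?thesis
    using f g closed F
    by (intro is_decompositionI[where F = ?F]) (auto simp: is_decomposition_def)
qed

lemma is_decomposition_single: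
  assumes "i \<in> I" "x \<in> W i" "\<And>j. j \<in> I \<Longrightarrow> 0 \<in> W j"
  shows "is_decomposition I W x (\<lambda>j. if j = i then x else 0)"
  by (rule is_decompositionI[where F = "{i}"]) (use assms in auto)

section \<open>Traces of sums of rank-one maps\<close>

context vector_space
begin

lemma finite_extend_basis_empty:
  assumes "finite_dimensional"
  shows "finite (extend_basis {})"
  using assms independent_span_bound[OF _ independent_extend_basis[OF independent_empty]]
  unfolding finite_dimensional_def by (metis subset_UNIV)

lemma trace_add: "trace (\<lambda>x. f x + g x) = trace f + trace g"
  unfolding trace_def
  by (simp add: representation_add independent_extend_basis independent_empty sum.distrib)

text \<open>Expanding each \<open>v i\<close> in the basis and exchanging the two sums reduces this
  to linearity of \<open>\<phi> i\<close>. The vectors \<open>v i\<close> may be dependent, so a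
  trace can be read off from any expansion of an operator into rank-one terms.\<close>

lemma trace_sum_rank_one:
  assumes fin: "finite_dimensional" and I: "finite I"
    and lin: "\<And>i. i \<in> I \<Longrightarrow> Vector_Spaces.linear scale (*) (\<phi> i)"
  shows "trace (\<lambda>x. \<Sum>i\<in>I. \<phi> i x *s v i) = (\<Sum>i\<in>I. \<phi> i (v i))"
proof -
  let ?A = "extend_basis {}"
  have A: "independent ?A" "span ?A = UNIV" "finite ?A"
    using independent_extend_basis span_extend_basis independent_empty
      finite_extend_basis_empty[OF fin] by auto
  have expand: "\<phi> i (v i) = (\<Sum>a\<in>?A. \<phi> i a * representation ?A (v i) a)" if "i \<in> I" for i
  proof -
    interpret \<phi>: module_hom scale "(*)" "\<phi> i"
      using lin[OF that] by (simp add: module_hom_iff_linear)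
    have "v i = (\<Sum>a\<in>?A. representation ?A (v i) a *s a)"
      using sum_representation_eq[OF A(1) _ A(3) order_refl, of "v i"] A(2) by simp
    then have "\<phi> i (v i) = \<phi> i (\<Sum>a\<in>?A. representation ?A (v i) a *s a)"
      by simp
    then show ?thesis
      by (simp add: \<phi>.sum \<phi>.scale mult.commute)
  qed
  have "trace (\<lambda>x. \<Sum>i\<in>I. \<phi> i x *s v i)
      = (\<Sum>a\<in>?A. \<Sum>i\<in>I. \<phi> i a * representation ?A (v i) a)"
    unfolding trace_def by (simp add: A representation_sum representation_scale)
  also have "\<dots> = (\<Sum>i\<in>I. \<phi> i (v i))"
    by (subst sum.swap) (simp add: expand)
  finally show ?thesis .
qed

lemma subspace_dim_le_1_multiple:
  assumes fin: "finite_dimensional" and dim: "dim S \<le> 1"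
    and x: "x \<in> S" "x \<noteq> 0" and y: "y \<in> S"
  obtains c where "y = c *s x"
proof -
  interpret fd: finite_dimensional_vector_space scale "extend_basis {}"
    using finite_extend_basis_empty[OF fin] independent_extend_basis span_extend_basis
      independent_empty by unfold_locales auto
  have "y \<in> span {x}"
  proof (rule ccontr)
    assume ny: "y \<notin> span {x}"
    then have "independent {y, x}"
      using x by (simp add: independent_insert)
    then have "card {y, x} \<le> dim S"
      using x y by (intro fd.independent_card_le_dim) auto
    moreover have "y \<noteq> x"
      using ny span_base by blast
    ultimately show False
      using dim by simp
  qed
  then show thesis
    using that by (auto simp: span_singleton)
qed

end

section \<open>Colour Lie algebras\<close>

context commutation_factor
begin

lemma eps_nonzero: "eps a b \<noteq> 0"
  using eps_inverse[of a b] by auto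

lemma eps_zero_left [simp]: "eps 0 b = 1"
  using eps_add_left[of 0 0 b] eps_nonzero[of 0 b] by simp

lemma eps_zero_right [simp]: "eps b 0 = 1"
  using eps_add_right[of b 0 0] eps_nonzero[of b 0] by simp

text \<open>Both sides are inverse to \<open>eps a b\<close>. Expressing the inverse by swapped
  arguments removes negated degrees without introducing division.\<close>

lemma eps_minus_left [simp]: "eps (- a) b = eps b a"
proof -
  have "eps (- a) b * eps a b = eps b a * eps a b"
    using eps_add_left[of "- a" a b] eps_inverse[of b a] by simp
  then show ?thesis
    using eps_nonzero[of a b] by simp
qed

lemma eps_minus_right [simp]: "eps b (- a) = eps a b"
proof -
  have "eps b (- a) * eps b a = eps a b * eps b a"
    using eps_add_right[of b "- a" a] eps_inverse[of a b] by simp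
  then show ?thesis
    using eps_nonzero[of b a] by simp
qed

lemma eps_diff_right: "eps c (a - b) = eps c a * eps b c"
  using eps_add_right[of c a "- b"] by simp

text \<open>The mixed factors \<open>eps a b\<close> and \<open>eps b a\<close> cancel, so
  \<open>a\<close> \<mapsto> \<open>eps a a\<close> is multiplicative.\<close>

lemma eps_self_add: "eps (a + b) (a + b) = eps a a * eps b b"
proof -
  have "eps (a + b) (a + b) = eps a a * eps b b * (eps a b * eps b a)"
    by (simp add: eps_add_left eps_add_right)
  then show ?thesis
    by (simp add: eps_inverse)
qed

lemma eps_self_square [simp]: "eps a a * eps a a = 1"
  by (rule eps_inverse)

end

context eps_graded_vector_space
begin

lemma component_decomposition: "is_decomposition UNIV V x (component x)"
  unfolding component_def using grading unfolding internal_direct_sum_def by (metis theI')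

lemma component_eqI: "is_decomposition UNIV V x f \<Longrightarrow> component x = f"
  using internal_direct_sum_unique[OF grading] component_decomposition by blast

lemma component_in: "component x a \<in> V a"
  using component_decomposition by (simp add: is_decomposition_def)

lemma finite_component: "finite {a. component x a \<noteq> 0}"
  using component_decomposition[of x] by (simp add: is_decomposition_def)

lemma sum_component: "x = (\<Sum>a | component x a \<noteq> 0. component x a)"
  using component_decomposition[of x] by (simp add: is_decomposition_def)

lemma component_add: "component (x + y) = (\<lambda>a. component x a + component y a)"
  by (intro component_eqI is_decomposition_plus component_decomposition)
    (simp add: subspace_add subspace_component)

lemma component_homogeneous: "x \<in> V a \<Longrightarrow> component x = (\<lambda>b. if b = a then x else 0)"
  by (intro component_eqI is_decomposition_single)
    (auto simp: subspace_component subspace_0)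

lemma component_scale: "component (c *s x) = (\<lambda>a. c *s component x a)"
  by (rule component_eqI, rule is_decomposition_additive[where W = V and T = "scale c"])
    (auto simp: component_decomposition scale_right_distrib subspace_scale subspace_component)

lemma degree_unique:
  assumes "x \<in> V a" "x \<in> V b" "x \<noteq> 0"
  shows "a = b"
  using component_homogeneous[OF assms(1)] component_homogeneous[OF assms(2)] assms(3)
  by (metis (full_types))

lemma eps_el_eq: "x \<in> V a \<Longrightarrow> x \<noteq> 0 \<Longrightarrow> eps_el x = eps a a"
  unfolding eps_el_def deg_def by (metis (mono_tags, lifting) degree_unique the_equality)

text \<open>Gives several vectors a common index set, as additivity of \<open>eps_map\<close>
  requires.\<close>

lemma eps_map_sum_superset:
  assumes "finite F" "{a. component x a \<noteq> 0} \<subseteq> F"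
  shows "eps_map x = (\<Sum>a\<in>F. eps a a *s component x a)"
  unfolding eps_map_def by (rule sum.mono_neutral_left) (use assms in auto)

lemma eps_map_homogeneous: "x \<in> V a \<Longrightarrow> eps_map x = eps a a *s x"
  by (subst eps_map_sum_superset[where F = "{a}"]) (auto simp: component_homogeneous)

lemma eps_map_add: "eps_map (x + y) = eps_map x + eps_map y"
proof -
  let ?F = "{a. component x a \<noteq> 0} \<union> {a. component y a \<noteq> 0}"
  have "finite ?F"
    by (simp add: finite_component)
  then show ?thesis
    by (subst (1 2 3) eps_map_sum_superset[where F = ?F])
      (auto simp: component_add scale_right_distrib sum.distrib)
qed

lemma eps_map_scale: "eps_map (c *s x) = c *s eps_map x"
  by (subst (1 2) eps_map_sum_superset[where F = "{a. component x a \<noteq> 0}"])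
    (auto simp: finite_component component_scale scale_sum_right mult.commute)

lemma eps_map_sum: "eps_map (\<Sum>i\<in>I. g i) = (\<Sum>i\<in>I. eps_map (g i))"
  by (induction I rule: infinite_finite_induct) (use eps_map_scale[of 0 0] in \<open>auto simp: eps_map_add\<close>)

end

context colour_lie_algebra
begin

lemma br_linear_right: "module_hom scale scale (br x)"
  using linear_br_right by (simp add: module_hom_iff_linear)

lemma br_linear_left: "module_hom scale scale (\<lambda>x. br x y)"
  using linear_br_left by (simp add: module_hom_iff_linear)

lemmas br_add_right = module_hom.add[OF br_linear_right]
  and br_scale_right = module_hom.scale[OF br_linear_right]
  and br_zero_right [simp] = module_hom.zero[OF br_linear_right]
  and br_neg_right = module_hom.neg[OF br_linear_right]
  and br_sum_right = module_hom.sum[OF br_linear_right]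

lemmas br_scale_left = module_hom.scale[OF br_linear_left]

text \<open>The Jacobi identity read as the statement that \<open>br x\<close> is a graded
  derivation: antisymmetry reverses \<open>br z x\<close> and \<open>br z (br x y)\<close>.\<close>

lemma br_leibniz:
  assumes x: "x \<in> V a" and y: "y \<in> V b" and z: "z \<in> V c"
  shows "br x (br y z) = br (br x y) z + eps a b *s br y (br x z)"
proof -
  \<comment> \<open>The factor \<open>eps c a\<close> is the coefficient of the first Jacobi term;
    it is invertible and is cancelled at the end.\<close>
  have "eps c a *s br x (br y z) = eps c a *s (br (br x y) z + eps a b *s br y (br x z))"
  proof -
    have zx: "br z x = - (eps c a *s br x z)"
      using br_antisym[OF z x] .
    have zxy: "br z (br x y) = - (eps c (a + b) *s br (br x y) z)"
      using br_antisym[OF z br_graded[OF x y]] .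
    have "eps b c * (eps c a * eps c b) = eps c a * (eps b c * eps c b)"
      by (simp add: ac_simps)
    also have "\<dots> = eps c a"
      by (simp add: eps_inverse)
    finally have e: "eps b c * (eps c a * eps c b) = eps c a" .
    show ?thesis
      using br_jacobi[OF x y z] unfolding zx zxy
      by (simp add: br_neg_right br_scale_right eps_add_right e scale_right_distrib
          algebra_simps eq_neg_iff_add_eq_0)
  qed
  then show ?thesis
    using eps_nonzero[of c a] by simp
qed

end

section \<open>Root vectors\<close>

definition neg :: "('v \<Rightarrow> 'k::ab_group_add) \<Rightarrow> 'v \<Rightarrow> 'k" where
  "neg \<alpha> = (\<lambda>h. - \<alpha> h)"

lemma neg_apply [simp]: "neg \<alpha> h = - \<alpha> h"
  by (simp add: neg_def)

lemma neg_neg [simp]: "neg (neg \<alpha>) = \<alpha>"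
  by (simp add: neg_def)

locale basic_killing_algebra = colour_lie_algebra scale V eps br
  for scale :: "'k::field_char_0 \<Rightarrow> 'v::ab_group_add \<Rightarrow> 'v" (infixr "*s" 75)
    and V :: "'g::ab_group_add \<Rightarrow> 'v set"
    and eps :: "'g \<Rightarrow> 'g \<Rightarrow> 'k"
    and br :: "'v \<Rightarrow> 'v \<Rightarrow> 'v" +
  fixes B :: "'v \<Rightarrow> 'v \<Rightarrow> 'k" and H :: "'v set" and Pos :: "('v \<Rightarrow> 'k) set"
  assumes finite_dim: "finite_dimensional"
    and B_killing: "B = killing_form"
    and B_quadratic: "eps_quadratic B"
    and data: "basic_data H Pos"
begin

abbreviation "\<Delta> \<equiv> roots H"

section \<open>The invariant form and the root spaces\<close>

lemma B_linear_right: "Vector_Spaces.linear scale (*) (B x)"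
  and B_linear_left: "Vector_Spaces.linear scale (*) (\<lambda>x. B x y)"
  using B_quadratic by (auto simp: eps_quadratic_def bilinear_form_def)

lemmas B_hom_right = B_linear_right[folded module_hom_iff_linear]
  and B_hom_left = B_linear_left[folded module_hom_iff_linear]

lemmas B_add_right = module_hom.add[OF B_hom_right]
  and B_scale_right = module_hom.scale[OF B_hom_right]
  and B_zero_right [simp] = module_hom.zero[OF B_hom_right]
  and B_neg_right = module_hom.neg[OF B_hom_right]
  and B_sum_right = module_hom.sum[OF B_hom_right]

lemmas B_add_left = module_hom.add[OF B_hom_left]
  and B_scale_left = module_hom.scale[OF B_hom_left]
  and B_zero_left [simp] = module_hom.zero[OF B_hom_left]
  and B_neg_left = module_hom.neg[OF B_hom_left]
  and B_diff_left = module_hom.diff[OF B_hom_left]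
  and B_sum_left = module_hom.sum[OF B_hom_left]

lemma B_degree: "x \<in> V a \<Longrightarrow> y \<in> V b \<Longrightarrow> B x y \<noteq> 0 \<Longrightarrow> a + b = 0"
  using B_quadratic unfolding eps_quadratic_def bilinear_form_def by blast

lemma B_sym: "x \<in> V a \<Longrightarrow> y \<in> V b \<Longrightarrow> B x y = eps a b * B y x"
  using B_quadratic unfolding eps_quadratic_def by blast

lemma B_inv:
  "x \<in> V a \<Longrightarrow> y \<in> V b \<Longrightarrow> z \<in> V c \<Longrightarrow> B (br x y) z = - (eps a b * B y (br x z))"
  using B_quadratic unfolding eps_quadratic_def by (metis mult_minus_left)

lemma B_nondegenerate: "(\<And>y. B x y = 0) \<Longrightarrow> x = 0"
  using B_quadratic unfolding eps_quadratic_def nondegenerate_def by blast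

text \<open>Invariance is assumed only for homogeneous vectors; for \<open>h\<close> of degree 0 the
  commutation factor is 1, so it extends to all vectors by linearity, first in \<open>y\<close> and
  then in \<open>x\<close>.\<close>

lemma B_inv_degree_zero:
  assumes h: "h \<in> V 0"
  shows "B (br h x) y = - B x (br h y)"
proof -
  have 1: "B (br h x) y = - B x (br h y)" if x: "x \<in> V b" for x y b
  proof -
    let ?F = "{a. component y a \<noteq> 0}"
    have "B (br h x) (sum (component y) ?F) = - B x (br h (sum (component y) ?F))"
      using B_inv[OF h x component_in]
      by (simp add: B_sum_right br_sum_right sum_negf)
    then show ?thesis
      by (simp flip: sum_component)
  qed
  let ?F = "{a. component x a \<noteq> 0}"
  have "B (br h (sum (component x) ?F)) y = - B (sum (component x) ?F) (br h y)"
    using 1[OF component_in]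
    by (simp add: B_sum_left br_sum_right sum_negf)
  then show ?thesis
    by (simp flip: sum_component)
qed

lemma H_subspace: "subspace H"
  and H_degree: "h \<in> H \<Longrightarrow> h \<in> V 0"
  and root_dim: "\<alpha> \<in> dual H \<Longrightarrow> \<alpha> \<noteq> (\<lambda>_. 0) \<Longrightarrow> dim (root_space H \<alpha>) \<le> 1"
  and root_decomposition: "internal_direct_sum (dual H) (root_space H)"
  and root_space_zero: "root_space H (\<lambda>_. 0) = H"
  using data unfolding basic_data_def cartan_subalgebra_def by auto

lemma positive_systemE:
  obtains Neg where "\<Delta> = Pos \<union> Neg" "Pos \<inter> Neg = {}"
    "\<And>\<alpha>. \<alpha> \<in> Pos \<Longrightarrow> neg \<alpha> \<in> Neg" "\<And>\<alpha>. \<alpha> \<in> Neg \<Longrightarrow> neg \<alpha> \<in> Pos"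
    "positively_independent Pos"
  using data unfolding basic_data_def positive_system_def neg_def by blast

lemma neg_root: "\<alpha> \<in> \<Delta> \<Longrightarrow> neg \<alpha> \<in> \<Delta>"
  by (metis positive_systemE Un_iff)

lemma root_dual: "\<alpha> \<in> \<Delta> \<Longrightarrow> \<alpha> \<in> dual H"
  and root_nonzero: "\<alpha> \<in> \<Delta> \<Longrightarrow> \<alpha> \<noteq> (\<lambda>_. 0)"
  by (auto simp: roots_def)

lemma root_spaceD: "x \<in> root_space H \<alpha> \<Longrightarrow> h \<in> H \<Longrightarrow> br h x = \<alpha> h *s x"
  by (simp add: root_space_def)

text \<open>The Cartan subalgebra is abelian because it equals its own zero root space.\<close>

lemma br_H_H: "h \<in> H \<Longrightarrow> h' \<in> H \<Longrightarrow> br h h' = 0"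
  using root_spaceD[of h' "\<lambda>_. 0" h] by (simp add: root_space_zero)

lemma subspace_root_space: "subspace (root_space H \<alpha>)"
  by (rule subspaceI)
    (auto simp: root_space_def br_add_right br_scale_right scale_right_distrib mult.commute)

text \<open>The operators \<open>br h\<close> have degree 0, so they act on each component
  separately with the same eigenvalue.\<close>

lemma component_in_root_space:
  assumes x: "x \<in> root_space H \<alpha>"
  shows "component x a \<in> root_space H \<alpha>"
proof -
  have "br h (component x a) = \<alpha> h *s component x a" if h: "h \<in> H" for h
  proof -
    have "component (br h x) = (\<lambda>a. br h (component x a))"
      by (rule component_eqI, rule is_decomposition_additive[where W = V and T = "br h"])
        (use br_graded[OF H_degree[OF h]] in \<open>auto simp: component_decomposition br_add_right\<close>)
    moreover have "component (br h x) = (\<lambda>a. \<alpha> h *s component x a)"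
      by (simp add: root_spaceD[OF x h] component_scale)
    ultimately show ?thesis
      by metis
  qed
  then show ?thesis
    by (simp add: root_space_def)
qed

lemma homogeneous_root_vector_exists:
  assumes "\<alpha> \<in> \<Delta>"
  shows "\<exists>x a. x \<noteq> 0 \<and> x \<in> root_space H \<alpha> \<and> x \<in> V a"
proof -
  obtain x where x: "x \<in> root_space H \<alpha>" "x \<noteq> 0"
    using assms subspace_0[OF subspace_root_space] unfolding roots_def by blast
  then obtain a where "component x a \<noteq> 0"
    by (metis sum_component sum.neutral)
  then show ?thesis
    using component_in_root_space[OF x(1)] component_in by blast
qed

section \<open>Homogeneous root vectors and the scalars attached to them\<close>

definition root_vec :: "('v \<Rightarrow> 'k) \<Rightarrow> 'v" where
  "root_vec \<alpha> = (SOME x. x \<noteq> 0 \<and> x \<in> root_space H \<alpha> \<and> (\<exists>a. x \<in> V a))"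

definition root_degree :: "('v \<Rightarrow> 'k) \<Rightarrow> 'g" where
  "root_degree \<alpha> = (SOME a. root_vec \<alpha> \<in> V a)"

definition root_sign :: "('v \<Rightarrow> 'k) \<Rightarrow> 'k" ("\<epsilon>") where
  "\<epsilon> \<alpha> = eps (root_degree \<alpha>) (root_degree \<alpha>)"

definition pairing :: "('v \<Rightarrow> 'k) \<Rightarrow> 'k" where
  "pairing \<alpha> = B (root_vec \<alpha>) (root_vec (neg \<alpha>))"

text \<open>This is the vector \<open>h_\<alpha>\<close> that represents \<alpha> on
  \<open>H\<close> through \<open>B\<close>; \<open>B_dual_root_vec\<close> proves it.\<close>

definition dual_root_vec :: "('v \<Rightarrow> 'k) \<Rightarrow> 'v" where
  "dual_root_vec \<alpha> = (1 / pairing \<alpha>) *s br (root_vec \<alpha>) (root_vec (neg \<alpha>))"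

text \<open>The coefficient along \<open>root_vec \<alpha>\<close> in the root decomposition,
  defined through \<open>B\<close> so that its linearity is immediate.\<close>

definition coord :: "('v \<Rightarrow> 'k) \<Rightarrow> 'v \<Rightarrow> 'k" where
  "coord \<alpha> x = B x (root_vec (neg \<alpha>)) / pairing \<alpha>"

definition cartan_part :: "'v \<Rightarrow> 'v" where
  "cartan_part x = x - (\<Sum>\<alpha>\<in>\<Delta>. coord \<alpha> x *s root_vec \<alpha>)"

definition ad_pairing :: "('v \<Rightarrow> 'k) \<Rightarrow> ('v \<Rightarrow> 'k) \<Rightarrow> 'k" where
  "ad_pairing \<alpha> \<beta> = B (br (root_vec \<alpha>) (br (root_vec (neg \<alpha>)) (root_vec \<beta>))) (root_vec (neg \<beta>))"

text \<open>The scalar by which \<open>ad(e\<^sub>\<alpha>) ad(e\<^sub>-\<^sub>\<alpha>) / B(e\<^sub>\<alpha>, e\<^sub>-\<^sub>\<alpha>)\<close> acts on the root line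
  of \<open>\<beta>\<close>, multiplied by \<open>\<epsilon>(\<alpha>) \<epsilon>(\<beta>)\<close>; it does not depend on the choice of root vectors.\<close>

definition weight :: "('v \<Rightarrow> 'k) \<Rightarrow> ('v \<Rightarrow> 'k) \<Rightarrow> 'k" where
  "weight \<alpha> \<beta> = \<epsilon> \<alpha> * \<epsilon> \<beta> * ad_pairing \<alpha> \<beta> / (pairing \<alpha> * pairing \<beta>)"

lemma root_vec_props:
  assumes "\<alpha> \<in> \<Delta>"
  shows root_vec_nonzero: "root_vec \<alpha> \<noteq> 0" and root_vec_root_space: "root_vec \<alpha> \<in> root_space H \<alpha>"
    and root_vec_degree: "root_vec \<alpha> \<in> V (root_degree \<alpha>)"
proof -
  have "\<exists>x. x \<noteq> 0 \<and> x \<in> root_space H \<alpha> \<and> (\<exists>a. x \<in> V a)"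
    using homogeneous_root_vector_exists[OF assms] by blast
  then have *: "root_vec \<alpha> \<noteq> 0 \<and> root_vec \<alpha> \<in> root_space H \<alpha> \<and> (\<exists>a. root_vec \<alpha> \<in> V a)"
    unfolding root_vec_def by (rule someI_ex)
  then show "root_vec \<alpha> \<noteq> 0" "root_vec \<alpha> \<in> root_space H \<alpha>"
    by auto
  show "root_vec \<alpha> \<in> V (root_degree \<alpha>)"
    unfolding root_degree_def using * by (metis someI_ex)
qed

lemma root_space_line:
  assumes "\<alpha> \<in> \<Delta>" "x \<in> root_space H \<alpha>"
  obtains c where "x = c *s root_vec \<alpha>"
  using subspace_dim_le_1_multiple[OF finite_dim root_dim[OF root_dual root_nonzero]
      root_vec_root_space root_vec_nonzero assms(2)] assms(1) by blast

lemma root_eps_eq: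
  assumes "\<alpha> \<in> \<Delta>"
  shows "root_eps H \<alpha> = \<epsilon> \<alpha>"
proof -
  have "eps_el x = \<epsilon> \<alpha>" if x: "x \<in> root_space H \<alpha>" "x \<noteq> 0" for x
  proof -
    obtain c where "x = c *s root_vec \<alpha>"
      using root_space_line[OF assms x(1)] .
    then have "x \<in> V (root_degree \<alpha>)"
      using root_vec_degree[OF assms] subspace_scale subspace_component by blast
    then show ?thesis
      using x(2) by (simp add: eps_el_eq root_sign_def)
  qed
  then show ?thesis
    unfolding root_eps_def using root_vec_root_space[OF assms] root_vec_nonzero[OF assms]
    by (intro the_equality) blast+
qed

text \<open>Moving \<open>h\<close> across the form gives
  \<open>(\<alpha> h + \<beta> h) * B x y = 0\<close>.\<close>

lemma root_spaces_orthogonal: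
  assumes "x \<in> root_space H \<alpha>" "y \<in> root_space H \<beta>" "h \<in> H" "\<alpha> h + \<beta> h \<noteq> 0"
  shows "B x y = 0"
proof -
  have "\<alpha> h * B x y = - (\<beta> h * B x y)"
    using B_inv_degree_zero[OF H_degree[OF assms(3)], of x y] assms
    by (simp add: root_spaceD B_scale_left B_scale_right)
  then have "(\<alpha> h + \<beta> h) * B x y = 0"
    by (simp add: distrib_right)
  then show ?thesis
    using assms(4) by simp
qed

lemma dual_outside: "\<alpha> \<in> dual H \<Longrightarrow> h \<notin> H \<Longrightarrow> \<alpha> h = 0"
  by (simp add: dual_def)

lemma root_spaces_orthogonal_neg:
  assumes "\<alpha> \<in> dual H" "\<beta> \<in> dual H" "\<beta> \<noteq> neg \<alpha>"
    and "x \<in> root_space H \<alpha>" "y \<in> root_space H \<beta>"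
  shows "B x y = 0"
proof -
  obtain h where "\<beta> h \<noteq> - \<alpha> h"
    using assms(3) by (auto simp: neg_def)
  \<comment> \<open>Elements of \<open>dual H\<close> vanish outside \<open>H\<close>, so a point
    where \<beta> and \<open>neg \<alpha>\<close> differ must lie in \<open>H\<close>.\<close>
  then have "h \<in> H" "\<alpha> h + \<beta> h \<noteq> 0"
    using dual_outside[OF assms(1)] dual_outside[OF assms(2)]
    by (metis minus_zero, simp add: add_eq_0_iff)
  then show ?thesis
    using root_spaces_orthogonal assms by blast
qed

text \<open>Only the line of \<open>neg \<alpha>\<close> can pair with
  \<open>root_vec \<alpha>\<close>. If that pairing vanished too, \<open>root_vec \<alpha>\<close>
  would be in the radical of \<open>B\<close>.\<close>

lemma pairing_nonzero:
  assumes \<alpha>: "\<alpha> \<in> \<Delta>"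
  shows "pairing \<alpha> \<noteq> 0"
proof
  assume b: "pairing \<alpha> = 0"
  have "B (root_vec \<alpha>) y = 0" for y
  proof -
    obtain f where f: "is_decomposition (dual H) (root_space H) y f"
      using root_decomposition unfolding internal_direct_sum_def by blast
    have "B (root_vec \<alpha>) (f \<beta>) = 0" if "f \<beta> \<noteq> 0" for \<beta>
    proof -
      have \<beta>: "\<beta> \<in> dual H" "f \<beta> \<in> root_space H \<beta>"
        using f that unfolding is_decomposition_def by blast+
      show ?thesis
      proof (cases "\<beta> = neg \<alpha>")
        case True
        then obtain c where "f \<beta> = c *s root_vec (neg \<alpha>)"
          using root_space_line[OF neg_root[OF \<alpha>]] \<beta> by blast
        then show ?thesis
          using b by (simp add: B_scale_right pairing_def)
      next
        case False
        then show ?thesis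
          using root_spaces_orthogonal_neg[OF root_dual[OF \<alpha>] \<beta>(1) _ root_vec_root_space[OF \<alpha>] \<beta>(2)]
          by blast
      qed
    qed
    then show ?thesis
      using f by (simp add: is_decomposition_def B_sum_right)
  qed
  then show False
    using B_nondegenerate root_vec_nonzero[OF \<alpha>] by blast
qed

text \<open>The form has degree 0 and pairs opposite root vectors non-trivially, so their degrees
  are opposite.\<close>

lemma root_degree_neg: "\<alpha> \<in> \<Delta> \<Longrightarrow> root_degree (neg \<alpha>) = - root_degree \<alpha>"
  using B_degree[OF root_vec_degree root_vec_degree[OF neg_root]] pairing_nonzero
  by (metis pairing_def neg_eq_iff_add_eq_0)

lemma root_vec_neg_degree: "\<alpha> \<in> \<Delta> \<Longrightarrow> root_vec (neg \<alpha>) \<in> V (- root_degree \<alpha>)"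
  using root_vec_degree[OF neg_root] by (simp add: root_degree_neg)

lemma root_sign_neg: "\<alpha> \<in> \<Delta> \<Longrightarrow> \<epsilon> (neg \<alpha>) = \<epsilon> \<alpha>"
  by (simp add: root_sign_def root_degree_neg)

lemma root_sign_square [simp]: "\<epsilon> \<alpha> * \<epsilon> \<alpha> = 1" "\<epsilon> \<alpha> * (\<epsilon> \<alpha> * x) = x"
  by (simp_all add: root_sign_def flip: mult.assoc)

lemma root_sign_nonzero: "\<epsilon> \<alpha> \<noteq> 0"
  by (simp add: root_sign_def eps_nonzero)

lemma pairing_neg: "\<alpha> \<in> \<Delta> \<Longrightarrow> pairing (neg \<alpha>) = \<epsilon> \<alpha> * pairing \<alpha>"
  using B_sym[OF root_vec_neg_degree root_vec_degree] by (simp add: pairing_def root_sign_def)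

section \<open>Coordinates along the root vectors and projection onto \<open>H\<close>\<close>

lemma coord_linear: "Vector_Spaces.linear scale (*) (coord \<alpha>)"
proof -
  have "module_hom scale (*) (coord \<alpha>)"
    using module_hom.axioms(1,2)[OF B_hom_right]
    by (intro module_hom.intro module_hom_axioms.intro)
      (simp_all add: coord_def B_add_left B_scale_left add_divide_distrib)
  then show ?thesis
    by (simp add: module_hom_iff_linear)
qed

lemma coord_root_vec: "\<alpha> \<in> \<Delta> \<Longrightarrow> coord \<alpha> (root_vec \<alpha>) = 1"
  using pairing_nonzero by (simp add: coord_def pairing_def)

text \<open>Pairing with \<open>root_vec (neg \<alpha>)\<close> annihilates every summand except the
  one at \<alpha>.\<close>

lemma decomposition_root_part:
  assumes f: "is_decomposition (dual H) (root_space H) x f" and \<alpha>: "\<alpha> \<in> \<Delta>"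
  shows "f \<alpha> = coord \<alpha> x *s root_vec \<alpha>"
proof -
  have "f \<alpha> \<in> root_space H \<alpha>"
    using f root_dual[OF \<alpha>] by (simp add: is_decomposition_def)
  then obtain c where c: "f \<alpha> = c *s root_vec \<alpha>"
    using root_space_line[OF \<alpha>] by blast
  have other: "B (f \<beta>) (root_vec (neg \<alpha>)) = 0" if "f \<beta> \<noteq> 0" "\<beta> \<noteq> \<alpha>" for \<beta>
  proof (rule root_spaces_orthogonal_neg)
    show "\<beta> \<in> dual H" "f \<beta> \<in> root_space H \<beta>"
      using f that unfolding is_decomposition_def by blast+
    show "neg \<alpha> \<noteq> neg \<beta>"
      using that(2) by (metis neg_neg)
  qed (use root_dual root_vec_root_space neg_root \<alpha> in auto)
  have fin: "finite (insert \<alpha> {\<beta>. f \<beta> \<noteq> 0})"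
    using f by (simp add: is_decomposition_def)
  have "x = sum f (insert \<alpha> {\<beta>. f \<beta> \<noteq> 0})"
    using is_decomposition_sum[OF f fin] by blast
  then have "B x (root_vec (neg \<alpha>)) = (\<Sum>\<beta>\<in>insert \<alpha> {\<beta>. f \<beta> \<noteq> 0}. B (f \<beta>) (root_vec (neg \<alpha>)))"
    by (metis B_sum_left)
  also have "\<dots> = (\<Sum>\<beta>\<in>{\<alpha>}. B (f \<beta>) (root_vec (neg \<alpha>)))"
    by (rule sum.mono_neutral_right[OF fin]) (use other in auto)
  also have "\<dots> = c * pairing \<alpha>"
    by (simp add: c B_scale_left pairing_def)
  finally show ?thesis
    using pairing_nonzero[OF \<alpha>] by (simp add: c coord_def)
qed

text \<open>Each root must occur in the finite decomposition of some member of a finite spanning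
  set; otherwise \<open>coord \<alpha>\<close> would vanish everywhere, although it is 1 on
  \<open>root_vec \<alpha>\<close>.\<close>

lemma finite_roots: "finite \<Delta>"
proof -
  obtain S where S: "finite S" "span S = UNIV"
    using finite_dim unfolding finite_dimensional_def by blast
  define f where "f x = (THE f. is_decomposition (dual H) (root_space H) x f)" for x
  have f: "is_decomposition (dual H) (root_space H) x (f x)" for x
    unfolding f_def using root_decomposition unfolding internal_direct_sum_def by (metis theI')
  have "\<exists>s\<in>S. f s \<alpha> \<noteq> 0" if \<alpha>: "\<alpha> \<in> \<Delta>" for \<alpha>
  proof (rule ccontr)
    assume "\<not> ?thesis"
    then have "coord \<alpha> s = 0" if "s \<in> S" for s
      using decomposition_root_part[OF f \<alpha>] root_vec_nonzero[OF \<alpha>] that by (metis scale_eq_0_iff)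
    moreover have "root_vec \<alpha> \<in> span S"
      using S by simp
    ultimately have "coord \<alpha> (root_vec \<alpha>) = 0"
      using module_hom.eq_0_on_span[OF coord_linear[folded module_hom_iff_linear]] by blast
    then show False
      using coord_root_vec[OF \<alpha>] by simp
  qed
  then have "\<Delta> \<subseteq> (\<Union>s\<in>S. {\<alpha>. f s \<alpha> \<noteq> 0})"
    by blast
  moreover have "finite (\<Union>s\<in>S. {\<alpha>. f s \<alpha> \<noteq> 0})"
    using S(1) f unfolding is_decomposition_def by blast
  ultimately show ?thesis
    by (rule finite_subset)
qed

lemma cartan_part_in_H: "cartan_part x \<in> H"
proof -
  obtain f where f: "is_decomposition (dual H) (root_space H) x f"
    using root_decomposition unfolding internal_direct_sum_def by blast
  let ?z = "\<lambda>_. 0 :: 'k"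
  \<comment> \<open>A functional with a non-zero part of \<open>x\<close> is a root or zero, so the
    Cartan part is exactly the part at the zero functional.\<close>
  have supp: "{\<beta>. f \<beta> \<noteq> 0} \<subseteq> insert ?z \<Delta>"
  proof safe
    fix \<beta> assume \<beta>: "f \<beta> \<noteq> 0" "\<beta> \<notin> \<Delta>"
    then have "\<beta> \<in> dual H" "f \<beta> \<in> root_space H \<beta>"
      using f unfolding is_decomposition_def by blast+
    then show "\<beta> = ?z"
      using \<beta> by (auto simp: roots_def)
  qed
  have z: "?z \<notin> \<Delta>"
    using root_nonzero by blast
  have "x = sum f (insert ?z \<Delta>)"
    by (rule is_decomposition_sum[OF f _ supp]) (simp add: finite_roots)
  also have "\<dots> = f ?z + (\<Sum>\<alpha>\<in>\<Delta>. coord \<alpha> x *s root_vec \<alpha>)"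
    by (simp add: z finite_roots decomposition_root_part[OF f])
  finally have "cartan_part x = f ?z"
    unfolding cartan_part_def by (metis add_diff_cancel_right')
  moreover have "f ?z \<in> H"
    using f root_space_zero subspace_0[OF H_subspace] unfolding is_decomposition_def by metis
  ultimately show ?thesis
    by simp
qed

lemma root_expansion: "x = cartan_part x + (\<Sum>\<alpha>\<in>\<Delta>. coord \<alpha> x *s root_vec \<alpha>)"
  by (simp add: cartan_part_def)

lemma zero_dual: "(\<lambda>_. 0) \<in> dual H"
  by (simp add: dual_def)

lemma B_H_root_vec:
  assumes "h \<in> H" "\<alpha> \<in> \<Delta>"
  shows "B h (root_vec \<alpha>) = 0" and "B (root_vec \<alpha>) h = 0"
proof -
  have "\<alpha> \<noteq> neg (\<lambda>_. 0)" "(\<lambda>_. 0) \<noteq> neg \<alpha>"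
    using root_nonzero[OF assms(2)] by (auto simp: neg_def fun_eq_iff)
  then show "B h (root_vec \<alpha>) = 0" "B (root_vec \<alpha>) h = 0"
    using root_spaces_orthogonal_neg[OF zero_dual root_dual[OF assms(2)] _ _ root_vec_root_space[OF assms(2)]]
      root_spaces_orthogonal_neg[OF root_dual[OF assms(2)] zero_dual _ root_vec_root_space[OF assms(2)]]
      assms(1) by (simp_all add: root_space_zero)
qed

text \<open>Root vectors are orthogonal to \<open>H\<close>, so a vector of \<open>H\<close>
  orthogonal to \<open>H\<close> is orthogonal to the whole space.\<close>

lemma B_nondegenerate_H:
  assumes h: "h \<in> H" "h' \<in> H" and eq: "\<And>y. y \<in> H \<Longrightarrow> B h y = B h' y"
  shows "h = h'"
proof -
  have "B (h - h') y = 0" for y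
  proof -
    have "B (h - h') (cartan_part y + (\<Sum>\<alpha>\<in>\<Delta>. coord \<alpha> y *s root_vec \<alpha>)) = 0"
      by (simp add: B_add_right B_diff_left B_sum_right B_scale_right B_H_root_vec h
          eq[OF cartan_part_in_H])
    then show ?thesis
      by (simp flip: root_expansion)
  qed
  then show ?thesis
    using B_nondegenerate[of "h - h'"] by simp
qed

section \<open>Brackets of root vectors and the vectors representing roots\<close>

lemma br_root_space:
  assumes "x \<in> root_space H \<alpha>" "y \<in> root_space H \<beta>" "x \<in> V a" "y \<in> V c"
  shows "br x y \<in> root_space H (\<lambda>h. \<alpha> h + \<beta> h)"
proof -
  have "br h (br x y) = (\<alpha> h + \<beta> h) *s br x y" if h: "h \<in> H" for h
    using br_leibniz[OF H_degree[OF h] assms(3,4)] assms(1,2) h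
    by (simp add: root_spaceD br_scale_left br_scale_right scale_left_distrib)
  then show ?thesis
    by (simp add: root_space_def)
qed

lemma br_root_vecs:
  "\<alpha> \<in> \<Delta> \<Longrightarrow> \<beta> \<in> \<Delta> \<Longrightarrow> br (root_vec \<alpha>) (root_vec \<beta>) \<in> root_space H (\<lambda>h. \<alpha> h + \<beta> h)"
  by (rule br_root_space[OF root_vec_root_space root_vec_root_space root_vec_degree root_vec_degree])

lemma br_root_vec_neg: "\<alpha> \<in> \<Delta> \<Longrightarrow> br (root_vec \<alpha>) (root_vec (neg \<alpha>)) = pairing \<alpha> *s dual_root_vec \<alpha>"
  by (simp add: dual_root_vec_def pairing_nonzero)

lemma dual_root_vec_in_H:
  assumes "\<alpha> \<in> \<Delta>"
  shows "dual_root_vec \<alpha> \<in> H"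
proof -
  have "br (root_vec \<alpha>) (root_vec (neg \<alpha>)) \<in> root_space H (\<lambda>h. \<alpha> h + neg \<alpha> h)"
    by (intro br_root_vecs neg_root assms)
  then show ?thesis
    using H_subspace by (simp add: dual_root_vec_def root_space_zero subspace_scale)
qed

lemma br_root_vec_H:
  assumes "\<alpha> \<in> \<Delta>" "h \<in> H"
  shows "br (root_vec \<alpha>) h = - (\<alpha> h *s root_vec \<alpha>)"
  using br_antisym[OF root_vec_degree[OF assms(1)] H_degree[OF assms(2)]] assms
  by (simp add: root_spaceD root_vec_root_space)

text \<open>Invariance moves \<open>root_vec \<alpha>\<close> across the form, where it acts on
  \<open>h\<close> by \<open>- \<alpha> h\<close>; the factor \<open>\<epsilon> \<alpha>\<close> is
  absorbed by \<open>pairing_neg\<close>.\<close>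

lemma B_dual_root_vec:
  assumes \<alpha>: "\<alpha> \<in> \<Delta>" and h: "h \<in> H"
  shows "B (dual_root_vec \<alpha>) h = \<alpha> h" and "B h (dual_root_vec \<alpha>) = \<alpha> h"
proof -
  have "B (br (root_vec \<alpha>) (root_vec (neg \<alpha>))) h = - (\<epsilon> \<alpha> * B (root_vec (neg \<alpha>)) (br (root_vec \<alpha>) h))"
    using B_inv[OF root_vec_degree[OF \<alpha>] root_vec_neg_degree[OF \<alpha>] H_degree[OF h]]
    by (simp add: root_sign_def)
  also have "\<dots> = \<epsilon> \<alpha> * \<alpha> h * pairing (neg \<alpha>)"
    by (simp add: br_root_vec_H[OF \<alpha> h] B_neg_right B_scale_right pairing_def)
  also have "\<dots> = pairing \<alpha> * \<alpha> h"
    by (simp add: pairing_neg[OF \<alpha>])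
  finally show 1: "B (dual_root_vec \<alpha>) h = \<alpha> h"
    using pairing_nonzero[OF \<alpha>] by (simp add: dual_root_vec_def B_scale_left)
  show "B h (dual_root_vec \<alpha>) = \<alpha> h"
    using B_sym[OF H_degree[OF h] H_degree[OF dual_root_vec_in_H[OF \<alpha>]]] 1 by simp
qed

section \<open>Traces of products of adjoint operators\<close>

lemma dual_vector_eqI:
  assumes "h \<in> H" "\<And>y. y \<in> H \<Longrightarrow> \<mu> y = B h y"
  shows "dual_vector B H \<mu> = h"
  unfolding dual_vector_def using assms B_nondegenerate_H by (intro the_equality) auto

text \<open>Here the hypothesis that \<open>B\<close> is the Killing form enters; it is evaluated on
  pairs in \<open>H\<close> and on opposite root vectors.\<close>

lemma B_trace: "B x y = trace (eps_map \<circ> (ad x \<circ> ad y))"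
  unfolding B_killing killing_form_def eps_trace_def ..

text \<open>The product of the two adjoint operators kills \<open>H\<close> and acts on the line of
  \<alpha> by \<open>\<alpha> h * \<alpha> h'\<close>; \<open>eps_map\<close> contributes the
  sign.\<close>

lemma killing_H:
  assumes h: "h \<in> H" "h' \<in> H"
  shows "B h h' = (\<Sum>\<alpha>\<in>\<Delta>. \<epsilon> \<alpha> * \<alpha> h * \<alpha> h')"
proof -
  have "(eps_map \<circ> (ad h \<circ> ad h')) x
      = (\<Sum>\<alpha>\<in>\<Delta>. coord \<alpha> x *s ((\<epsilon> \<alpha> * \<alpha> h * \<alpha> h') *s root_vec \<alpha>))" for x
  proof -
    have "br h' x = br h' (cartan_part x + (\<Sum>\<alpha>\<in>\<Delta>. coord \<alpha> x *s root_vec \<alpha>))"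
      by (simp flip: root_expansion)
    also have "\<dots> = (\<Sum>\<alpha>\<in>\<Delta>. (coord \<alpha> x * \<alpha> h') *s root_vec \<alpha>)"
      by (simp add: br_add_right br_sum_right br_scale_right br_H_H[OF h(2) cartan_part_in_H]
          root_spaceD[OF root_vec_root_space h(2)])
    finally show ?thesis
      by (simp add: ad_def br_sum_right br_scale_right root_spaceD[OF root_vec_root_space h(1)]
          eps_map_sum eps_map_scale eps_map_homogeneous[OF root_vec_degree] root_sign_def ac_simps)
  qed
  then have "eps_map \<circ> (ad h \<circ> ad h')
      = (\<lambda>x. \<Sum>\<alpha>\<in>\<Delta>. coord \<alpha> x *s ((\<epsilon> \<alpha> * \<alpha> h * \<alpha> h') *s root_vec \<alpha>))"
    by (rule ext)
  then have "B h h' = (\<Sum>\<alpha>\<in>\<Delta>. coord \<alpha> ((\<epsilon> \<alpha> * \<alpha> h * \<alpha> h') *s root_vec \<alpha>))"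
    by (simp only: B_trace[of h h'] trace_sum_rank_one[OF finite_dim finite_roots coord_linear])
  also have "\<dots> = (\<Sum>\<alpha>\<in>\<Delta>. \<epsilon> \<alpha> * \<alpha> h * \<alpha> h')"
    by (rule sum.cong)
      (auto simp: module_hom.scale[OF coord_linear[folded module_hom_iff_linear]] coord_root_vec)
  finally show ?thesis .
qed

text \<open>The vectors dual to the roots form a frame of the Cartan subalgebra, which is used to compute
  traces without choosing a basis of it.\<close>

lemma H_expansion:
  assumes h: "h \<in> H"
  shows "h = (\<Sum>\<alpha>\<in>\<Delta>. (\<epsilon> \<alpha> * \<alpha> h) *s dual_root_vec \<alpha>)"
proof (rule B_nondegenerate_H[OF h])
  show "(\<Sum>\<alpha>\<in>\<Delta>. (\<epsilon> \<alpha> * \<alpha> h) *s dual_root_vec \<alpha>) \<in> H"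
    by (intro subspace_sum H_subspace subspace_scale dual_root_vec_in_H)
  show "B h y = B (\<Sum>\<alpha>\<in>\<Delta>. (\<epsilon> \<alpha> * \<alpha> h) *s dual_root_vec \<alpha>) y" if "y \<in> H" for y
    by (simp add: B_sum_left B_scale_left killing_H[OF h that] B_dual_root_vec[OF _ that])
qed

text \<open>Rewrites this value as a pairing with \<open>x\<close> itself, the linear functional
  that \<open>trace_sum_rank_one\<close> takes.\<close>

lemma root_cartan_part:
  assumes \<alpha>: "\<alpha> \<in> \<Delta>"
  shows "\<alpha> (cartan_part x) = B x (dual_root_vec \<alpha>)"
proof -
  have "B x (dual_root_vec \<alpha>) = B (cartan_part x + (\<Sum>\<alpha>\<in>\<Delta>. coord \<alpha> x *s root_vec \<alpha>)) (dual_root_vec \<alpha>)"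
    by (simp flip: root_expansion)
  then show ?thesis
    by (simp add: B_add_left B_sum_left B_scale_left B_H_root_vec[OF dual_root_vec_in_H[OF \<alpha>]]
        B_dual_root_vec[OF \<alpha> cartan_part_in_H])
qed

lemma scaled_B_linear: "Vector_Spaces.linear scale (*) (\<lambda>x. c * B x y)"
proof -
  have "module_hom scale (*) (\<lambda>x. c * B x y)"
    using module_hom.axioms(1,2)[OF B_hom_right]
    by (intro module_hom.intro module_hom_axioms.intro)
      (simp_all add: B_add_left B_scale_left distrib_left)
  then show ?thesis
    by (simp add: module_hom_iff_linear)
qed

lemma eps_map_H: "h \<in> H \<Longrightarrow> eps_map h = h"
  using eps_map_homogeneous[OF H_degree] by simp

lemma eps_map_expansion:
  "eps_map x = cartan_part x + (\<Sum>\<alpha>\<in>\<Delta>. coord \<alpha> x *s (\<epsilon> \<alpha> *s root_vec \<alpha>))"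
proof -
  have "eps_map (cartan_part x + (\<Sum>\<alpha>\<in>\<Delta>. coord \<alpha> x *s root_vec \<alpha>))
      = cartan_part x + (\<Sum>\<alpha>\<in>\<Delta>. coord \<alpha> x *s (\<epsilon> \<alpha> *s root_vec \<alpha>))"
    by (simp add: eps_map_add eps_map_sum eps_map_scale eps_map_H[OF cartan_part_in_H]
        eps_map_homogeneous[OF root_vec_degree] root_sign_def)
  then show ?thesis
    by (simp flip: root_expansion)
qed

lemma coord_scale_root_vec: "\<alpha> \<in> \<Delta> \<Longrightarrow> coord \<alpha> (c *s root_vec \<alpha>) = c"
  by (simp add: module_hom.scale[OF coord_linear[folded module_hom_iff_linear]] coord_root_vec)

text \<open>The first sum is the trace of the projection onto \<open>H\<close>, written with the
  frame of vectors dual to the roots; the second collects the root lines.\<close>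

lemma eps_dim_eq: "eps_dim = (\<Sum>\<alpha>\<in>\<Delta>. \<epsilon> \<alpha> * \<alpha> (dual_root_vec \<alpha>)) + (\<Sum>\<alpha>\<in>\<Delta>. \<epsilon> \<alpha>)"
proof -
  have "eps_map \<circ> id = (\<lambda>x. (\<Sum>\<alpha>\<in>\<Delta>. (\<epsilon> \<alpha> * B x (dual_root_vec \<alpha>)) *s dual_root_vec \<alpha>)
      + (\<Sum>\<alpha>\<in>\<Delta>. coord \<alpha> x *s (\<epsilon> \<alpha> *s root_vec \<alpha>)))"
  proof
    fix x
    have "cartan_part x = (\<Sum>\<alpha>\<in>\<Delta>. (\<epsilon> \<alpha> * B x (dual_root_vec \<alpha>)) *s dual_root_vec \<alpha>)"
      using H_expansion[OF cartan_part_in_H[of x]] by (simp add: root_cartan_part)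
    then show "(eps_map \<circ> id) x = (\<Sum>\<alpha>\<in>\<Delta>. (\<epsilon> \<alpha> * B x (dual_root_vec \<alpha>)) *s dual_root_vec \<alpha>)
      + (\<Sum>\<alpha>\<in>\<Delta>. coord \<alpha> x *s (\<epsilon> \<alpha> *s root_vec \<alpha>))"
      using eps_map_expansion[of x] by simp
  qed
  then have "eps_dim = (\<Sum>\<alpha>\<in>\<Delta>. \<epsilon> \<alpha> * B (dual_root_vec \<alpha>) (dual_root_vec \<alpha>)) + (\<Sum>\<alpha>\<in>\<Delta>. coord \<alpha> (\<epsilon> \<alpha> *s root_vec \<alpha>))"
    by (simp only: eps_dim_def eps_trace_def trace_add
        trace_sum_rank_one[OF finite_dim finite_roots coord_linear]
        trace_sum_rank_one[OF finite_dim finite_roots scaled_B_linear])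
  then show ?thesis
    by (simp add: B_dual_root_vec dual_root_vec_in_H coord_scale_root_vec)
qed

text \<open>The composite preserves the line of \<beta>, and pairing with
  \<open>root_vec (neg \<beta>)\<close> identifies the scalar.\<close>

lemma br_root_vec_br:
  assumes \<alpha>: "\<alpha> \<in> \<Delta>" and \<beta>: "\<beta> \<in> \<Delta>"
  shows "br (root_vec \<alpha>) (br (root_vec (neg \<alpha>)) (root_vec \<beta>)) = (ad_pairing \<alpha> \<beta> / pairing \<beta>) *s root_vec \<beta>"
proof -
  have "br (root_vec (neg \<alpha>)) (root_vec \<beta>) \<in> root_space H (\<lambda>h. neg \<alpha> h + \<beta> h)"
    by (intro br_root_vecs neg_root \<alpha> \<beta>)
  moreover have "br (root_vec (neg \<alpha>)) (root_vec \<beta>) \<in> V (root_degree (neg \<alpha>) + root_degree \<beta>)"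
    by (intro br_graded root_vec_degree neg_root \<alpha> \<beta>)
  ultimately have "br (root_vec \<alpha>) (br (root_vec (neg \<alpha>)) (root_vec \<beta>)) \<in> root_space H (\<lambda>h. \<alpha> h + (neg \<alpha> h + \<beta> h))"
    by (rule br_root_space[OF root_vec_root_space[OF \<alpha>] _ root_vec_degree[OF \<alpha>]])
  then have "br (root_vec \<alpha>) (br (root_vec (neg \<alpha>)) (root_vec \<beta>)) \<in> root_space H \<beta>"
    by simp
  then obtain c where c: "br (root_vec \<alpha>) (br (root_vec (neg \<alpha>)) (root_vec \<beta>)) = c *s root_vec \<beta>"
    using root_space_line[OF \<beta>] by blast
  then have "ad_pairing \<alpha> \<beta> = c * pairing \<beta>"
    by (simp add: ad_pairing_def pairing_def B_scale_left)
  then show ?thesis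
    using c pairing_nonzero[OF \<beta>] by simp
qed

text \<open>The Killing form on \<open>root_vec \<alpha>\<close> and
  \<open>root_vec (neg \<alpha>)\<close> is both \<open>pairing \<alpha>\<close> and a trace. The
  Cartan part contributes \<open>pairing \<alpha> * \<alpha> (dual_root_vec \<alpha>)\<close>, and
  the root lines contribute the weights up to a common factor.\<close>

lemma killing_root:
  assumes \<alpha>: "\<alpha> \<in> \<Delta>"
  shows "(\<Sum>\<beta>\<in>\<Delta>. weight \<alpha> \<beta>) = \<epsilon> \<alpha> * (1 - \<alpha> (dual_root_vec \<alpha>))"
proof -
  let ?T = "eps_map \<circ> (ad (root_vec \<alpha>) \<circ> ad (root_vec (neg \<alpha>)))"
  \<comment> \<open>On \<open>H\<close> the operator has rank at most one; the singleton sum puts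
    that term in the shape of \<open>trace_sum_rank_one\<close>.\<close>
  have "?T = (\<lambda>x. (\<Sum>i\<in>{\<alpha>}. (pairing i * B x (dual_root_vec i)) *s dual_root_vec i)
      + (\<Sum>\<beta>\<in>\<Delta>. coord \<beta> x *s ((\<epsilon> \<beta> * ad_pairing \<alpha> \<beta> / pairing \<beta>) *s root_vec \<beta>)))"
  proof
    fix x
    have "br (root_vec (neg \<alpha>)) x
        = br (root_vec (neg \<alpha>)) (cartan_part x + (\<Sum>\<alpha>\<in>\<Delta>. coord \<alpha> x *s root_vec \<alpha>))"
      by (simp flip: root_expansion)
    also have "\<dots> = \<alpha> (cartan_part x) *s root_vec (neg \<alpha>)
        + (\<Sum>\<beta>\<in>\<Delta>. coord \<beta> x *s br (root_vec (neg \<alpha>)) (root_vec \<beta>))"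
      by (simp add: br_add_right br_sum_right br_scale_right
          br_root_vec_H[OF neg_root[OF \<alpha>] cartan_part_in_H])
    finally show "?T x = (\<Sum>i\<in>{\<alpha>}. (pairing i * B x (dual_root_vec i)) *s dual_root_vec i)
      + (\<Sum>\<beta>\<in>\<Delta>. coord \<beta> x *s ((\<epsilon> \<beta> * ad_pairing \<alpha> \<beta> / pairing \<beta>) *s root_vec \<beta>))"
      by (simp add: ad_def br_add_right br_sum_right br_scale_right br_root_vec_br[OF \<alpha>]
          br_root_vec_neg[OF \<alpha>] eps_map_add eps_map_sum eps_map_scale eps_map_homogeneous[OF root_vec_degree]
          eps_map_H[OF dual_root_vec_in_H[OF \<alpha>]] root_sign_def root_cartan_part[OF \<alpha>] ac_simps)
  qed
  then have "B (root_vec \<alpha>) (root_vec (neg \<alpha>)) = (\<Sum>i\<in>{\<alpha>}. pairing i * B (dual_root_vec i) (dual_root_vec i))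
      + (\<Sum>\<beta>\<in>\<Delta>. coord \<beta> ((\<epsilon> \<beta> * ad_pairing \<alpha> \<beta> / pairing \<beta>) *s root_vec \<beta>))"
    by (simp only: B_trace[of "root_vec \<alpha>"] trace_add finite.intros
        trace_sum_rank_one[OF finite_dim finite_roots coord_linear]
        trace_sum_rank_one[OF finite_dim _ scaled_B_linear])
  also have "\<dots> = pairing \<alpha> * \<alpha> (dual_root_vec \<alpha>) + (\<Sum>\<beta>\<in>\<Delta>. \<epsilon> \<beta> * ad_pairing \<alpha> \<beta> / pairing \<beta>)"
    by (simp add: B_dual_root_vec[OF \<alpha> dual_root_vec_in_H[OF \<alpha>]] coord_scale_root_vec)
  finally have "(\<Sum>\<beta>\<in>\<Delta>. \<epsilon> \<beta> * ad_pairing \<alpha> \<beta> / pairing \<beta>) = pairing \<alpha> * (1 - \<alpha> (dual_root_vec \<alpha>))"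
    by (simp add: algebra_simps flip: pairing_def)
  moreover have "(\<Sum>\<beta>\<in>\<Delta>. weight \<alpha> \<beta>) = \<epsilon> \<alpha> / pairing \<alpha> * (\<Sum>\<beta>\<in>\<Delta>. \<epsilon> \<beta> * ad_pairing \<alpha> \<beta> / pairing \<beta>)"
    by (simp add: weight_def sum_distrib_left mult.assoc)
  ultimately show ?thesis
    using pairing_nonzero[OF \<alpha>] by simp
qed

section \<open>The weights of pairs of roots\<close>

text \<open>Invariance turns the iterated bracket into a pairing of two simple brackets, from which
  both symmetries of \<open>weight\<close> are derived.\<close>

lemma ad_pairing_eq:
  assumes \<alpha>: "\<alpha> \<in> \<Delta>" and \<beta>: "\<beta> \<in> \<Delta>"
  shows "ad_pairing \<alpha> \<beta> = - (\<epsilon> \<alpha> * eps (root_degree \<alpha>) (root_degree \<beta>) * B (br (root_vec (neg \<alpha>)) (root_vec \<beta>)) (br (root_vec \<alpha>) (root_vec (neg \<beta>))))"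
  using B_inv[OF root_vec_degree[OF \<alpha>] br_graded[OF root_vec_neg_degree[OF \<alpha>] root_vec_degree[OF \<beta>]] root_vec_neg_degree[OF \<beta>]]
  by (simp add: ad_pairing_def root_sign_def eps_diff_right mult.commute)

text \<open>Moving \<open>root_vec (neg \<alpha>)\<close> across the form as well and swapping its
  arguments exchanges both roots with their negatives. The mixed commutation factors cancel; the
  remaining signs are those of \<open>pairing_neg\<close>.\<close>

lemma weight_neg_neg:
  assumes \<alpha>: "\<alpha> \<in> \<Delta>" and \<beta>: "\<beta> \<in> \<Delta>"
  shows "weight (neg \<alpha>) (neg \<beta>) = weight \<alpha> \<beta>"
proof -
  let ?a = "root_degree \<alpha>" and ?c = "root_degree \<beta>"
  let ?y = "br (root_vec (neg \<alpha>)) (br (root_vec \<alpha>) (root_vec (neg \<beta>)))"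
  have y1: "br (root_vec \<alpha>) (root_vec (neg \<beta>)) \<in> V (?a + - ?c)"
    by (intro br_graded root_vec_degree root_vec_neg_degree \<alpha> \<beta>)
  have y: "?y \<in> V (- ?a + (?a + - ?c))"
    by (intro br_graded y1 root_vec_degree root_vec_neg_degree \<alpha> \<beta>)
  have 1: "B (br (root_vec (neg \<alpha>)) (root_vec \<beta>)) (br (root_vec \<alpha>) (root_vec (neg \<beta>))) = - (eps ?c ?a * B (root_vec \<beta>) ?y)"
    using B_inv[OF root_vec_neg_degree[OF \<alpha>] root_vec_degree[OF \<beta>] y1] by simp
  have 2: "B (root_vec \<beta>) ?y = \<epsilon> \<beta> * ad_pairing (neg \<alpha>) (neg \<beta>)"
    using B_sym[OF root_vec_degree[OF \<beta>] y] by (simp add: ad_pairing_def root_sign_def)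
  have "ad_pairing \<alpha> \<beta> = \<epsilon> \<alpha> * (eps ?a ?c * eps ?c ?a) * \<epsilon> \<beta> * ad_pairing (neg \<alpha>) (neg \<beta>)"
    by (simp add: ad_pairing_eq[OF \<alpha> \<beta>] 1 2)
  then have "ad_pairing \<alpha> \<beta> = \<epsilon> \<alpha> * \<epsilon> \<beta> * ad_pairing (neg \<alpha>) (neg \<beta>)"
    by (simp add: eps_inverse)
  then show ?thesis
    using pairing_nonzero[OF \<alpha>] pairing_nonzero[OF \<beta>] root_sign_nonzero
    by (simp add: weight_def root_sign_neg \<alpha> \<beta> pairing_neg field_simps)
qed

text \<open>By antisymmetry, \<open>ad_pairing_eq\<close> for (\<alpha>, \<beta>) and for
  (\<open>neg \<beta>\<close>, \<open>neg \<alpha>\<close>) involves the same two brackets up to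
  commutation factors; \<open>weight_neg_neg\<close> then removes the negations.\<close>

lemma weight_commute:
  assumes \<alpha>: "\<alpha> \<in> \<Delta>" and \<beta>: "\<beta> \<in> \<Delta>"
  shows "weight \<alpha> \<beta> = weight \<beta> \<alpha>"
proof -
  let ?a = "root_degree \<alpha>" and ?c = "root_degree \<beta>"
  let ?X = "B (br (root_vec (neg \<alpha>)) (root_vec \<beta>)) (br (root_vec \<alpha>) (root_vec (neg \<beta>)))"
  have "br (root_vec \<beta>) (root_vec (neg \<alpha>)) = - (eps ?a ?c *s br (root_vec (neg \<alpha>)) (root_vec \<beta>))"
    using br_antisym[OF root_vec_degree[OF \<beta>] root_vec_neg_degree[OF \<alpha>]] by simp
  moreover have "br (root_vec (neg \<beta>)) (root_vec \<alpha>) = - (eps ?a ?c *s br (root_vec \<alpha>) (root_vec (neg \<beta>)))"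
    using br_antisym[OF root_vec_neg_degree[OF \<beta>] root_vec_degree[OF \<alpha>]] by simp
  ultimately have "ad_pairing (neg \<beta>) (neg \<alpha>) = - (\<epsilon> \<beta> * eps ?c ?a * (eps ?a ?c * eps ?a ?c) * ?X)"
    using ad_pairing_eq[OF neg_root[OF \<beta>] neg_root[OF \<alpha>]]
    by (simp add: root_sign_neg \<beta> root_degree_neg \<alpha> B_neg_left B_neg_right B_scale_left B_scale_right)
  also have "\<dots> = - (\<epsilon> \<beta> * (eps ?c ?a * eps ?a ?c) * eps ?a ?c * ?X)"
    by (simp only: ac_simps)
  also have "\<dots> = \<epsilon> \<alpha> * \<epsilon> \<beta> * ad_pairing \<alpha> \<beta>"
    by (simp add: eps_inverse ad_pairing_eq[OF \<alpha> \<beta>])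
  finally have "weight \<alpha> \<beta> = weight (neg \<beta>) (neg \<alpha>)"
    using pairing_nonzero[OF \<alpha>] pairing_nonzero[OF \<beta>] root_sign_nonzero
    by (simp add: weight_def root_sign_neg \<alpha> \<beta> pairing_neg field_simps)
  then show ?thesis
    using weight_neg_neg[OF \<beta> \<alpha>] by simp
qed

text \<open>By \<open>br_leibniz\<close>, exchanging the two adjoint operators costs the action of
  \<open>pairing \<alpha> *s dual_root_vec \<alpha>\<close> on the line of \<beta>.\<close>

lemma weight_diff_neg:
  assumes \<alpha>: "\<alpha> \<in> \<Delta>" and \<beta>: "\<beta> \<in> \<Delta>"
  shows "weight \<alpha> \<beta> - weight (neg \<alpha>) \<beta> = \<epsilon> \<alpha> * \<epsilon> \<beta> * \<beta> (dual_root_vec \<alpha>)"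
proof -
  have "br (root_vec \<alpha>) (br (root_vec (neg \<alpha>)) (root_vec \<beta>))
      = (pairing \<alpha> * \<beta> (dual_root_vec \<alpha>)) *s root_vec \<beta> + \<epsilon> \<alpha> *s br (root_vec (neg \<alpha>)) (br (root_vec \<alpha>) (root_vec \<beta>))"
    using br_leibniz[OF root_vec_degree[OF \<alpha>] root_vec_neg_degree[OF \<alpha>] root_vec_degree[OF \<beta>]]
    by (simp add: br_root_vec_neg \<alpha> br_scale_left root_spaceD[OF root_vec_root_space[OF \<beta>] dual_root_vec_in_H[OF \<alpha>]]
        root_sign_def)
  then have "ad_pairing \<alpha> \<beta> = pairing \<alpha> * \<beta> (dual_root_vec \<alpha>) * pairing \<beta> + \<epsilon> \<alpha> * ad_pairing (neg \<alpha>) \<beta>"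
    by (simp add: ad_pairing_def pairing_def B_add_left B_scale_left)
  then show ?thesis
    using pairing_nonzero[OF \<alpha>] pairing_nonzero[OF \<beta>] root_sign_nonzero
    by (simp add: weight_def root_sign_neg \<alpha> pairing_neg field_simps)
qed

lemma weight_self:
  assumes \<alpha>: "\<alpha> \<in> \<Delta>"
  shows "weight \<alpha> \<alpha> = \<epsilon> \<alpha> * \<alpha> (dual_root_vec \<alpha>)"
proof -
  have "br (root_vec (neg \<alpha>)) (root_vec \<alpha>) = - ((\<epsilon> \<alpha> * pairing \<alpha>) *s dual_root_vec \<alpha>)"
    using br_antisym[OF root_vec_neg_degree[OF \<alpha>] root_vec_degree[OF \<alpha>]]
    by (simp add: br_root_vec_neg[OF \<alpha>] root_sign_def)
  then have "ad_pairing \<alpha> \<alpha> = \<epsilon> \<alpha> * pairing \<alpha> * \<alpha> (dual_root_vec \<alpha>) * pairing \<alpha>"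
    by (simp add: ad_pairing_def br_neg_right br_scale_right br_root_vec_H[OF \<alpha> dual_root_vec_in_H[OF \<alpha>]] B_scale_left pairing_def)
  then show ?thesis
    using pairing_nonzero[OF \<alpha>] by (simp add: weight_def)
qed

text \<open>With \<open>s\<close> and \<open>t\<close> the scalars of the maps between the lines of
  \<beta> and \<beta> - \<alpha>, the two round trips are \<open>s * t\<close> and
  \<open>t * s\<close>.\<close>

lemma weight_shift:
  assumes \<alpha>: "\<alpha> \<in> \<Delta>" and \<beta>: "\<beta> \<in> \<Delta>" and \<gamma>: "(\<lambda>h. \<beta> h - \<alpha> h) \<in> \<Delta>" (is "?\<gamma> \<in> \<Delta>")
  shows "weight \<alpha> \<beta> = weight (neg \<alpha>) ?\<gamma>"
proof -
  have "br (root_vec (neg \<alpha>)) (root_vec \<beta>) \<in> root_space H (\<lambda>h. neg \<alpha> h + \<beta> h)"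
    by (intro br_root_vecs neg_root \<alpha> \<beta>)
  then obtain s where s: "br (root_vec (neg \<alpha>)) (root_vec \<beta>) = s *s root_vec ?\<gamma>"
    using root_space_line[OF \<gamma>] by auto
  have "br (root_vec \<alpha>) (root_vec ?\<gamma>) \<in> root_space H (\<lambda>h. \<alpha> h + ?\<gamma> h)"
    by (intro br_root_vecs \<alpha> \<gamma>)
  then obtain t where t: "br (root_vec \<alpha>) (root_vec ?\<gamma>) = t *s root_vec \<beta>"
    using root_space_line[OF \<beta>] by auto
  have q1: "ad_pairing \<alpha> \<beta> = s * t * pairing \<beta>"
    by (simp add: ad_pairing_def s t br_scale_right B_scale_left pairing_def)
  have q2: "ad_pairing (neg \<alpha>) ?\<gamma> = t * s * pairing ?\<gamma>"
    by (simp add: ad_pairing_def s t br_scale_right B_scale_left pairing_def)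
  show ?thesis
  proof (cases "s = 0")
    case True
    then show ?thesis
      by (simp add: weight_def q1 q2)
  next
    case False
    \<comment> \<open>As \<open>s\<close> is non-zero, the bracket is a non-zero vector on the line
      of \<open>?\<gamma>\<close>; this fixes the degree of that line and hence its sign.\<close>
    have "s *s root_vec ?\<gamma> \<in> V (- root_degree \<alpha> + root_degree \<beta>)"
      using br_graded[OF root_vec_neg_degree[OF \<alpha>] root_vec_degree[OF \<beta>]] s by simp
    moreover have "s *s root_vec ?\<gamma> \<in> V (root_degree ?\<gamma>)"
      using root_vec_degree[OF \<gamma>] subspace_scale subspace_component by blast
    ultimately have "root_degree ?\<gamma> = - root_degree \<alpha> + root_degree \<beta>"
      using False root_vec_nonzero[OF \<gamma>] degree_unique by (metis scale_eq_0_iff)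
    then have "\<epsilon> ?\<gamma> = \<epsilon> \<alpha> * \<epsilon> \<beta>"
      using eps_self_add[of "- root_degree \<alpha>" "root_degree \<beta>"] by (simp add: root_sign_def)
    then show ?thesis
      using pairing_nonzero[OF \<alpha>] pairing_nonzero[OF \<beta>] pairing_nonzero[OF \<gamma>] root_sign_nonzero[of \<alpha>]
      by (simp add: weight_def q1 q2 root_sign_neg[OF \<alpha>] pairing_neg[OF \<alpha>] field_simps)
  qed
qed

text \<open>The inner bracket lies in the root space of \<beta> - \<alpha>, a functional that is
  neither zero nor a root.\<close>

lemma weight_eq_zero:
  assumes \<alpha>: "\<alpha> \<in> \<Delta>" and \<beta>: "\<beta> \<in> \<Delta>" and "\<alpha> \<noteq> \<beta>"
    and \<gamma>: "(\<lambda>h. \<beta> h - \<alpha> h) \<notin> \<Delta>"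
  shows "weight \<alpha> \<beta> = 0"
proof -
  let ?\<gamma> = "\<lambda>h. \<beta> h - \<alpha> h"
  have "?\<gamma> \<in> dual H"
    using root_dual[OF \<alpha>] root_dual[OF \<beta>] by (simp add: dual_def algebra_simps)
  moreover have "?\<gamma> \<noteq> (\<lambda>_. 0)"
    using \<open>\<alpha> \<noteq> \<beta>\<close> by (metis eq_iff_diff_eq_0 ext)
  ultimately have "root_space H ?\<gamma> = {0}"
    using \<gamma> by (simp add: roots_def)
  moreover have "br (root_vec (neg \<alpha>)) (root_vec \<beta>) \<in> root_space H (\<lambda>h. neg \<alpha> h + \<beta> h)"
    by (intro br_root_vecs neg_root \<alpha> \<beta>)
  ultimately have "br (root_vec (neg \<alpha>)) (root_vec \<beta>) = 0"
    by simp
  then show ?thesis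
    by (simp add: weight_def ad_pairing_def)
qed

section \<open>Summation over the positive roots\<close>

lemma pos_root: "\<alpha> \<in> Pos \<Longrightarrow> \<alpha> \<in> \<Delta>"
  by (metis positive_systemE Un_iff)

lemma neg_pos_not_pos: "\<alpha> \<in> Pos \<Longrightarrow> neg \<alpha> \<notin> Pos"
  by (metis positive_systemE IntI empty_iff)

lemma root_pos_cases: "\<alpha> \<in> \<Delta> \<Longrightarrow> \<alpha> \<in> Pos \<or> neg \<alpha> \<in> Pos"
  by (metis positive_systemE Un_iff)

lemma finite_Pos: "finite Pos"
  using finite_roots pos_root by (meson finite_subset subsetI)

text \<open>Otherwise the negative of the sum is a positive root, and the three positive roots add
  up to zero, against positive independence.\<close>

lemma pos_add:
  assumes \<alpha>: "\<alpha> \<in> Pos" and \<beta>: "\<beta> \<in> Pos" and sum: "(\<lambda>h. \<alpha> h + \<beta> h) \<in> \<Delta>"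
  shows "(\<lambda>h. \<alpha> h + \<beta> h) \<in> Pos"
proof (rule ccontr)
  assume not_pos: "(\<lambda>h. \<alpha> h + \<beta> h) \<notin> Pos"
  define \<gamma> where "\<gamma> = neg (\<lambda>h. \<alpha> h + \<beta> h)"
  have \<gamma>: "\<gamma> \<in> Pos"
    using root_pos_cases[OF sum] not_pos by (simp add: \<gamma>_def)
  \<comment> \<open>Adding indicators gives the right multiplicities even when some of the three
    roots coincide.\<close>
  define c :: "('v \<Rightarrow> 'k) \<Rightarrow> int" where
    "c x = of_bool (x = \<alpha>) + of_bool (x = \<beta>) + of_bool (x = \<gamma>)" for x
  have single: "(\<Sum>x\<in>Pos. of_bool (x = y) * x h) = y h" if "y \<in> Pos" for y h
    using that finite_Pos by (simp add: of_bool_def if_distrib [of "\<lambda>u. u * _"] cong: if_cong)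
  have "(\<Sum>x\<in>Pos. of_int (c x) * x h) = \<alpha> h + \<beta> h + \<gamma> h" for h
    by (simp add: c_def distrib_right sum.distrib single \<alpha> \<beta> \<gamma>)
  then have "(\<Sum>x\<in>Pos. of_int (c x) * x h) = 0" for h
    by (simp add: \<gamma>_def)
  moreover have "positively_independent Pos"
    by (metis positive_systemE)
  moreover have "\<forall>x\<in>Pos. c x \<ge> 0"
    by (simp add: c_def)
  ultimately have "c \<alpha> = 0"
    using \<alpha> unfolding positively_independent_def by blast
  then show False
    by (auto simp: c_def of_bool_def split: if_splits)
qed

lemma sum_roots: "sum f \<Delta> = (\<Sum>\<alpha>\<in>Pos. f \<alpha>) + (\<Sum>\<alpha>\<in>Pos. f (neg \<alpha>))"
proof -
  have "\<Delta> = Pos \<union> neg ` Pos"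
    using root_pos_cases pos_root neg_root by (auto simp: image_iff) (metis neg_neg)
  moreover have "Pos \<inter> neg ` Pos = {}"
    using neg_pos_not_pos by auto
  moreover have "inj_on neg Pos"
    by (rule inj_onI) (metis neg_neg)
  ultimately show ?thesis
    by (simp add: sum.union_disjoint finite_Pos sum.reindex)
qed

text \<open>Pairs are sorted by whether \<beta> - \<alpha> is zero, positive, negative or not a
  root. The diagonal gives the first sum, the last class vanishes, and the positive and negative
  classes each give one copy of the sum of \<open>weight (neg \<alpha>) \<beta>\<close>.\<close>

lemma sum_weight_pos:
  "(\<Sum>\<alpha>\<in>Pos. \<Sum>\<beta>\<in>Pos. weight \<alpha> \<beta>)
    = (\<Sum>\<alpha>\<in>Pos. \<epsilon> \<alpha> * \<alpha> (dual_root_vec \<alpha>)) + 2 * (\<Sum>\<alpha>\<in>Pos. \<Sum>\<beta>\<in>Pos. weight (neg \<alpha>) \<beta>)"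
proof -
  let ?sub = "\<lambda>\<alpha> \<beta> h. \<alpha> h - \<beta> h :: 'k"
  let ?add = "\<lambda>\<alpha> \<beta> h. \<alpha> h + \<beta> h :: 'k"
  let ?w = "\<lambda>(\<alpha>, \<beta>). weight \<alpha> \<beta>"
  let ?PP = "Pos \<times> Pos"
  define S1 where "S1 = (\<lambda>\<alpha>. (\<alpha>, \<alpha>)) ` Pos"
  define S2 where "S2 = {(\<alpha>, \<beta>) \<in> ?PP. ?sub \<beta> \<alpha> \<in> Pos}"
  define S3 where "S3 = {(\<alpha>, \<beta>) \<in> ?PP. ?sub \<alpha> \<beta> \<in> Pos}"
  define T where "T = {(\<alpha>, \<delta>) \<in> ?PP. ?add \<alpha> \<delta> \<in> Pos}"
  have fin: "finite ?PP"
    by (simp add: finite_Pos)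
  have fins: "finite S1" "finite S2" "finite S3"
    unfolding S1_def S2_def S3_def using finite_Pos fin by (auto intro: finite_subset[OF _ fin])
  have neg_sub: "neg (?sub \<alpha> \<beta>) = ?sub \<beta> \<alpha>" for \<alpha> \<beta> :: "'v \<Rightarrow> 'k"
    by (simp add: neg_def)
  have zero: "?sub \<alpha> \<alpha> \<notin> Pos" for \<alpha> :: "'v \<Rightarrow> 'k"
    using pos_root root_nonzero by fastforce
  have disj: "S1 \<inter> S2 = {}" "(S1 \<union> S2) \<inter> S3 = {}"
    using zero neg_pos_not_pos neg_sub unfolding S1_def S2_def S3_def by fastforce+
  have "sum ?w ?PP = sum ?w (S1 \<union> S2 \<union> S3)"
  proof (rule sum.mono_neutral_right[OF fin])
    show "S1 \<union> S2 \<union> S3 \<subseteq> ?PP"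
      by (auto simp: S1_def S2_def S3_def)
    show "\<forall>p\<in>?PP - (S1 \<union> S2 \<union> S3). ?w p = 0"
    proof
      fix p assume "p \<in> ?PP - (S1 \<union> S2 \<union> S3)"
      then obtain \<alpha> \<beta> where p: "p = (\<alpha>, \<beta>)"
        and *: "\<alpha> \<in> Pos" "\<beta> \<in> Pos" "(\<alpha>, \<beta>) \<notin> S1 \<union> S2 \<union> S3"
        by blast
      then have "\<alpha> \<noteq> \<beta>" "?sub \<beta> \<alpha> \<notin> Pos" "neg (?sub \<beta> \<alpha>) \<notin> Pos"
        unfolding neg_sub by (auto simp: S1_def S2_def S3_def)
      then have "weight \<alpha> \<beta> = 0"
        using weight_eq_zero[OF pos_root[OF *(1)] pos_root[OF *(2)]] root_pos_cases by blast
      then show "?w p = 0"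
        by (simp add: p)
    qed
  qed
  also have "\<dots> = sum ?w S1 + sum ?w S2 + sum ?w S3"
    using fins disj by (simp add: sum.union_disjoint)
  also have "sum ?w S3 = sum ?w S2"
    by (rule sum.reindex_bij_witness[where i = prod.swap and j = prod.swap])
      (auto simp: S2_def S3_def intro: weight_commute pos_root)
  also have "sum ?w S1 = (\<Sum>\<alpha>\<in>Pos. \<epsilon> \<alpha> * \<alpha> (dual_root_vec \<alpha>))"
    unfolding S1_def by (subst sum.reindex) (auto simp: inj_on_def weight_self pos_root)
  \<comment> \<open>Substituting \<delta> = \<beta> - \<alpha> makes \<open>weight_shift\<close>
    applicable and turns the condition into positivity of \<alpha> + \<delta>.\<close>
  also have "sum ?w S2 = (\<Sum>(\<alpha>, \<delta>)\<in>T. weight (neg \<alpha>) \<delta>)"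
    by (rule sum.reindex_bij_witness[where i = "\<lambda>(\<alpha>, \<delta>). (\<alpha>, ?add \<alpha> \<delta>)"
          and j = "\<lambda>(\<alpha>, \<beta>). (\<alpha>, ?sub \<beta> \<alpha>)"])
      (auto simp: S2_def T_def weight_shift[OF pos_root pos_root pos_root])
  also have "\<dots> = (\<Sum>(\<alpha>, \<delta>)\<in>?PP. weight (neg \<alpha>) \<delta>)"
  proof (rule sum.mono_neutral_left[OF fin])
    show "T \<subseteq> ?PP"
      by (auto simp: T_def)
    show "\<forall>p\<in>?PP - T. (case p of (\<alpha>, \<delta>) \<Rightarrow> weight (neg \<alpha>) \<delta>) = 0"
    proof
      fix p assume "p \<in> ?PP - T"
      then obtain \<alpha> \<delta> where p: "p = (\<alpha>, \<delta>)" and *: "\<alpha> \<in> Pos" "\<delta> \<in> Pos" "(\<alpha>, \<delta>) \<notin> T"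
        by blast
      \<comment> \<open>This difference is \<alpha> + \<delta>; were it a root,
        \<open>pos_add\<close> would make it positive and put the pair into
        \<open>T\<close>.\<close>
      have "(\<lambda>h. \<delta> h - neg \<alpha> h) \<notin> \<Delta>"
        using * pos_add[OF *(1,2)] by (auto simp: T_def add.commute)
      moreover have "neg \<alpha> \<noteq> \<delta>"
        using neg_pos_not_pos * by blast
      ultimately have "weight (neg \<alpha>) \<delta> = 0"
        using weight_eq_zero[OF neg_root[OF pos_root[OF *(1)]] pos_root[OF *(2)]] by blast
      then show "(case p of (\<alpha>, \<delta>) \<Rightarrow> weight (neg \<alpha>) \<delta>) = 0"
        by (simp add: p)
    qed
  qed
  finally show ?thesis
    by (simp add: sum.cartesian_product)
qed

text \<open>Both sides evaluate
  \<open>B (dual_root_vec \<alpha>) (dual_root_vec (neg \<alpha>))\<close>.\<close>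

lemma root_dual_root_vec_neg:
  assumes \<alpha>: "\<alpha> \<in> \<Delta>"
  shows "\<alpha> (dual_root_vec (neg \<alpha>)) = - \<alpha> (dual_root_vec \<alpha>)"
  using B_dual_root_vec(1)[OF \<alpha> dual_root_vec_in_H[OF neg_root[OF \<alpha>]]] B_dual_root_vec(2)[OF neg_root[OF \<alpha>] dual_root_vec_in_H[OF \<alpha>]]
  by simp

text \<open>The Weyl vector is represented by half the signed sum of the vectors dual to the
  positive roots; the factor 4 clears the two halves.\<close>

lemma dual_form_weyl_vector:
  "4 * dual_form B H (weyl_vector H Pos) (weyl_vector H Pos)
    = (\<Sum>\<alpha>\<in>Pos. \<Sum>\<beta>\<in>Pos. \<epsilon> \<alpha> * \<epsilon> \<beta> * \<beta> (dual_root_vec \<alpha>))"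
proof -
  let ?h = "(1 / 2) *s (\<Sum>\<alpha>\<in>Pos. \<epsilon> \<alpha> *s dual_root_vec \<alpha>)"
  have "dual_vector B H (weyl_vector H Pos) = ?h"
  proof (rule dual_vector_eqI)
    show "?h \<in> H"
      by (intro subspace_scale subspace_sum H_subspace dual_root_vec_in_H pos_root)
    show "weyl_vector H Pos y = B ?h y" if "y \<in> H" for y
      by (simp add: weyl_vector_def B_scale_left B_sum_left B_dual_root_vec pos_root root_eps_eq that)
  qed
  then show ?thesis
    by (subst sum.swap) (simp add: dual_form_def B_scale_left B_scale_right B_sum_left B_sum_right
        B_dual_root_vec pos_root dual_root_vec_in_H sum_distrib_left ac_simps)
qed

theorem strange_formula:
  "eps_dim = 24 * dual_form B H (weyl_vector H Pos) (weyl_vector H Pos)"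
proof -
  define A where "A = (\<Sum>\<alpha>\<in>Pos. \<Sum>\<beta>\<in>Pos. weight \<alpha> \<beta>)"
  define N where "N = (\<Sum>\<alpha>\<in>Pos. \<Sum>\<beta>\<in>Pos. weight (neg \<alpha>) \<beta>)"
  define D where "D = (\<Sum>\<alpha>\<in>Pos. \<epsilon> \<alpha> * \<alpha> (dual_root_vec \<alpha>))"
  define E where "E = (\<Sum>\<alpha>\<in>Pos. \<epsilon> \<alpha>)"
  define P where "P = (\<Sum>\<alpha>\<in>Pos. \<Sum>\<beta>\<in>Pos. \<epsilon> \<alpha> * \<epsilon> \<beta> * \<beta> (dual_root_vec \<alpha>))"
  have "(\<Sum>\<alpha>\<in>\<Delta>. \<epsilon> \<alpha> * \<alpha> (dual_root_vec \<alpha>)) = D + D"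
    unfolding sum_roots D_def by (simp add: root_dual_root_vec_neg root_sign_neg pos_root)
  moreover have "(\<Sum>\<alpha>\<in>\<Delta>. \<epsilon> \<alpha>) = E + E"
    unfolding sum_roots E_def by (simp add: root_sign_neg pos_root)
  ultimately have dim: "eps_dim = 2 * D + 2 * E"
    by (simp add: eps_dim_eq)
  have AN: "A = D + 2 * N"
    unfolding A_def D_def N_def by (rule sum_weight_pos)
  have AP: "A - N = P"
    unfolding A_def N_def P_def
    by (simp add: weight_diff_neg pos_root flip: sum_subtractf)
  \<comment> \<open>Negating both roots turns the negative half of the sum over \<beta> into
    \<open>N\<close>.\<close>
  have "weight \<alpha> (neg \<beta>) = weight (neg \<alpha>) \<beta>" if "\<alpha> \<in> Pos" "\<beta> \<in> Pos" for \<alpha> \<beta>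
    using weight_neg_neg[OF neg_root[OF pos_root[OF that(1)]] pos_root[OF that(2)]] by simp
  then have "(\<Sum>\<alpha>\<in>Pos. \<Sum>\<beta>\<in>\<Delta>. weight \<alpha> \<beta>) = A + N"
    unfolding sum_roots A_def N_def by (simp add: sum.distrib)
  moreover have "(\<Sum>\<alpha>\<in>Pos. \<Sum>\<beta>\<in>\<Delta>. weight \<alpha> \<beta>) = E - D"
    by (simp add: killing_root pos_root E_def D_def right_diff_distrib sum_subtractf)
  ultimately have "E - D = A + N"
    by simp
  \<comment> \<open>From \<open>A = D + 2 * N\<close> follow \<open>P = D + N\<close> and
    \<open>E = 2 * D + 3 * N\<close>, so both sides equal \<open>6 * (D + N)\<close>.\<close>
  then have "2 * D + 2 * E = 6 * P"
    using AN by (simp add: algebra_simps flip: AP)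
  then show ?thesis
    using dim dual_form_weyl_vector by (simp add: P_def)
qed

end

theorem theorem1:
  fixes scale :: "'k::field_char_0 \<Rightarrow> 'v::ab_group_add \<Rightarrow> 'v"
    and V :: "'g::ab_group_add \<Rightarrow> 'v set"
    and eps :: "'g \<Rightarrow> 'g \<Rightarrow> 'k"
    and br :: "'v \<Rightarrow> 'v \<Rightarrow> 'v"
    and B :: "'v \<Rightarrow> 'v \<Rightarrow> 'k"
    and H :: "'v set"
    and Pos :: "('v \<Rightarrow> 'k) set"
    and \<rho> :: "'v \<Rightarrow> 'k"
  assumes "colour_lie_algebra scale V eps br"
    and "vector_space.finite_dimensional scale"
    and "B = colour_lie_algebra.killing_form scale V eps br"
    and "eps_graded_vector_space.nondegenerate B"
    and "colour_lie_algebra.basic scale V eps br B"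
    and "colour_lie_algebra.basic_data scale V br H Pos"
    and "\<rho> = colour_lie_algebra.weyl_vector scale V eps br H Pos"
  shows "eps_graded_vector_space.eps_dim scale V eps
    = 24 * colour_lie_algebra.dual_form B H \<rho> \<rho>"
proof -
  interpret colour_lie_algebra scale V eps br
    by fact
  \<comment> \<open>Unfolding \<open>basic\<close> supplies the quadratic axioms for
    \<open>B\<close>; \<open>H\<close> and \<open>Pos\<close> are the ones given by the
    \<open>basic_data\<close> hypothesis.\<close>
  interpret basic_killing_algebra scale V eps br B H Pos
    using assms by unfold_locales (auto simp: basic_def)
  show ?thesis
    using strange_formula assms(7) by simp
qed

end
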